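(* Let $f^{n+1}=\sum_{i=1}^rX_i^{n+1}L_i^{n+1}$ be the low-rank solution obtained after the L-step update of the first-order low-rank IMEX scheme (with time step $\Delta t$, parameter $\varepsilon$ and field $E^{n+1}$), and let $\rho^{n+1}=\langle f^{n+1},1\rangle_v^h$. Let $P_X^{n+1}$ be the orthogonal projector (with respect to $\langle\cdot,\cdot\rangle_x^h$, acting in the spatial variable) onto $\mathrm{span}\{X_i^{n+1}\}$, and let $$G^{n+1}:=\frac{f^{n+1}-f^{(2)}}{\Delta t}-P_X^{n+1}\mathcal A_h(f^{(2)}),$$ where $f^{(2)}=\sum_iX_i^{n+1}L_i^{(2)}$ is the input of the L-step. Let $M^{n+1}$, $\mathcal L_h^{n+1}$, $M_{\max}^{n+1}$, $\gamma_h$ and $\kappa_h$ be the discrete Maxwellian, discrete Fokker--Planck operator and constants associated with $E^{n+1}$ as defined in the context. Assume the small-fluctuation condition $$\kappa_h\,M_{\max}^{n+1}<\gamma_h,$$ and the formal asymptotic regime $0<\varepsilon\ll\Delta t\ll1$, in which the numerical solution and its discrete derivatives are bounded so that $\|G^{n+1}\|_{xv}^h=\mathcal O(1)$ as $\varepsilon\to0$. Set $\Theta:=\gamma_h/(\gamma_h-\kappa_hM_{\max}^{n+1})\ge1$. Then $$\big\|\mathcal L_h^{n+1}(f^{n+1})\big\|_{xv}^h\;\le\;\Theta\Big(\varepsilon\,\|G^{n+1}\|_{xv}^h+\kappa_h\,M_{\max}^{n+1}\sqrt{L_v}\,\|\rho^{n+1}\|_x^h\Big)$$ and $$\big\|f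^{n+1}-\rho^{n+1}M^{n+1}\big\|_{xv}^h\;\le\;\frac{M_{\max}^{n+1}}{\gamma_h}\,\Theta\Big(\varepsilon\,\|G^{n+1}\|_{xv}^h+\kappa_h\,M_{\max}^{n+1}\sqrt{L_v}\,\|\rho^{n+1}\|_x^h\Big).$$
   Context: Equation. The scheme approximates the Vlasov--Poisson--Fokker--Planck equation $\partial_tf=-v\,\partial_xf+\frac1\varepsilon\,\partial_v\big(M\partial_v(f/M)\big)$ in one space and one velocity dimension, with $M$ the Maxwellian in $v$ centered at the electric field $E(x,t)$, and $E=-\partial_x\phi$, $-\partial_{xx}\phi=\rho-\eta$ for a given background charge $\eta$. Grids. The space domain is $[x_{\min},x_{\max}]$ (periodic) and the velocity domain is $[v_{\min},v_{\max}]$ (zero flux), with $\Delta x=(x_{\max}-x_{\min})/N_x$, $\Delta v=(v_{\max}-v_{\min})/N_v$, $x_p=x_{\min}+(p-\tfrac12)\Delta x$ for $1\le p\le N_x$, $v_q=v_{\min}+(q-\tfrac12)\Delta v$ for $1\le q\le N_v$, and $L_v=v_{\max}-v_{\min}$. A phase-space grid function is a real array $(f_{p,q})$. Inner products. $\langle\phi,\psi\rangle_x^h=\sum_p\phi_p\psi_p\Delta x$, $\langle\phi,\psi\rangle_v^h=\sum_q\phi_q\psi_q\Delta v$, $\langle\phi,\psi\rangle_{xv}^h=\sum_{p,q}\phi_{p,q}\psi_{p,q}\Delta x\Delta v$, with norms $\|\cdot\|_x^h,\|\cdot\|_v^h,\|\cdot\|_{xv}^h$. When applied to phase-space grid functions,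 $\langle\cdot,\cdot\rangle_v^h$ (resp. $\langle\cdot,\cdot\rangle_x^h$) acts in $v$ (resp. $x$) only and returns a spatial (resp. velocity) grid function. $\rho M$ denotes row-wise scaling, $(\rho M)_{p,q}=\rho_pM_{p,q}$, and $X_iL_i$ denotes the grid function $X_{i,p}L_{i,q}$. Discrete Maxwellian and Fokker--Planck operator for the field $E^{n+1}=(E_p^{n+1})_p$. $M^{n+1}_{p,q}=c_p\exp(-(v_q-E_p^{n+1})^2/2)$, with $c_p>0$ chosen so that $\sum_qM^{n+1}_{p,q}\Delta v=1$ for each $p$; $M^{n+1}_{p,q+1/2}=\sqrt{M^{n+1}_{p,q}M^{n+1}_{p,q+1}}$ for $1\le q\le N_v-1$ (half-point maxima and minima are over these $q$). The operator $\mathcal L_h^{n+1}$ is $$[\mathcal L_h^{n+1}(f)]_{p,q}=\frac{1}{\Delta v}\big(\mathcal J_{p,q+1/2}-\mathcal J_{p,q-1/2}\big),\quad \mathcal J_{p,q+1/2}=M^{n+1}_{p,q+1/2}\frac{(f/M^{n+1})_{p,q+1}-(f/M^{n+1})_{p,q}}{\Delta v}\ (1\le q\le N_v-1),$$ with $\mathcal J_{p,1/2}=\mathcal J_{p,N_v+1/2}=0$. Constants (all for the field $E^{n+1}$). $M_{\min}=\min_{p,q}M^{n+1}_{p,q+1/2}$, $M_{\max}^{n+1}=\max\{\max_{p,q}M^{n+1}_{p,q},\max_{p,q}M^{n+1}_{p,q+1/2}\}$, $$\gamma_h=\frac{M_{\min}\lambda_N}{\big(1+\sqrt{L_vM_{\max}^{n+1}}\big)^2},\qquad\lambda_N=\frac{4}{\Delta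 v^2}\sin^2\Big(\frac{\pi}{2N_v}\Big).$$ With $\beta_p=\exp(-\tfrac{\Delta v}2E_p^{n+1})$, $\bar\beta=\frac1{N_x}\sum_p\beta_p$, $\|\delta\beta\|_\infty=\max_p|\beta_p-\bar\beta|$, $C_\beta=\max_p(\beta_p\bar\beta)^{-1}$, $\alpha_{q+1/2}=\exp(\tfrac{\Delta v}{4}(v_q+v_{q+1}))$ for $1\le q\le N_v-1$, and $\alpha_{\max},\alpha_{\min}$ the maximum and minimum of $\alpha_{q+1/2}$, $$\kappa_h=\|\delta\beta\|_\infty\Big(\frac{2\alpha_{\max}}{\Delta v^2}+C_\beta\frac{2}{\alpha_{\min}\Delta v^2}\Big).$$ First-order low-rank IMEX scheme. $\mathcal A_h$ denotes a discrete advection operator, i.e. a linear finite-difference approximation (e.g. upwind) of $f\mapsto-v\,\partial_xf$. Start from $f^n=\sum_{i,j=1}^rX_i^nS_{ij}^nV_j^n$, with $\{X_i^n\}$ and $\{V_j^n\}$ orthonormal for $\langle\cdot,\cdot\rangle_x^h$ and $\langle\cdot,\cdot\rangle_v^h$. The field $E^{n+1}$ is obtained from the Poisson equation with density $\hat\rho^{n+1}=\langle f^n,1\rangle_v^h+\Delta t\langle\mathcal A_h(f^n),1\rangle_v^h$; in the analysis $E^{n+1}$ is regarded as given and fixed. Then: K-step: with $K_j^n=\sum_iX_i^nS_{ij}^n$, find $K_j^{(1)}$, $j=1,\dots,r$, such that $\frac{K_j^{(1)}-K_j^n}{\Delta t}=\langle\mathcal A_h(f^n),V_j^n\rangle_v^h+\frac1\varepsilon\langle\mathcal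 L_h^{n+1}(f^{(1)}),V_j^n\rangle_v^h$, where $f^{(1)}=\sum_jK_j^{(1)}V_j^n$. A QR factorization $K_j^{(1)}=\sum_iX_i^{n+1}S_{ij}^{(1)}$ gives $\{X_i^{n+1}\}_{i=1}^r$, orthonormal for $\langle\cdot,\cdot\rangle_x^h$, and $S^{(1)}$. S-step: $\frac{S_{ij}^{(2)}-S_{ij}^{(1)}}{\Delta t}=-\langle\mathcal A_h(f^{(1)}),X_i^{n+1}V_j^n\rangle_{xv}^h-\frac1\varepsilon\langle\mathcal L_h^{n+1}(f^{(1)}),X_i^{n+1}V_j^n\rangle_{xv}^h$, where $f^{(1)}=\sum_{i,j}X_i^{n+1}S_{ij}^{(1)}V_j^n$. L-step: with $L_i^{(2)}=\sum_jS_{ij}^{(2)}V_j^n$ and $f^{(2)}=\sum_iX_i^{n+1}L_i^{(2)}$, find $L_i^{n+1}$, $i=1,\dots,r$, such that $\frac{L_i^{n+1}-L_i^{(2)}}{\Delta t}=\langle\mathcal A_h(f^{(2)}),X_i^{n+1}\rangle_x^h+\frac1\varepsilon\langle\mathcal L_h^{n+1}(f^{n+1}),X_i^{n+1}\rangle_x^h$, where $f^{n+1}=\sum_iX_i^{n+1}L_i^{n+1}$. Regime. The grids are fixed; constants such as $\gamma_h,\kappa_h$ may depend on $\Delta x,\Delta v$ but are required to be independent of $\varepsilon$. The formal asymptotic regime $0<\varepsilon\ll\Delta t\ll1$ means that the numerical solution and its discrete derivatives are treated as bounded ($\mathcal O(1)$) quantities, so that $\|G^{n+1}\|_{xv}^h$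 is bounded uniformly as $\varepsilon\to0$. *)

theory Defs
  imports Complex_Main "HOL-Library.Landau_Symbols"
begin

text \<open>Grid functions are functions on \<^typ>\<open>nat\<close> indices; only the values at the indices
  \<open>1 \<le> p \<le> Nx\<close>, \<open>1 \<le> q \<le> Nv\<close> are meaningful.\<close>

record phase_grid =
  Nx :: nat
  Nv :: nat
  xmin :: real
  xmax :: real
  vmin :: real
  vmax :: real

type_synonym grid_fun = "nat \<Rightarrow> real"
type_synonym phase_fun = "nat \<Rightarrow> nat \<Rightarrow> real"

text \<open>At least two velocity cells are needed for the interior half points
  \<open>q + 1/2\<close>, \<open>1 \<le> q \<le> Nv - 1\<close>, to exist.\<close>

definition valid_grid :: "phase_grid \<Rightarrow> bool" where
  "valid_grid g \<longleftrightarrow> 1 \<le> Nx g \<and> 2 \<le> Nv g \<and> xmin g < xmax g \<and> vmin g < vmax g"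

definition dx :: "phase_grid \<Rightarrow> real" where
  "dx g = (xmax g - xmin g) / real (Nx g)"

definition dv :: "phase_grid \<Rightarrow> real" where
  "dv g = (vmax g - vmin g) / real (Nv g)"

definition Lv :: "phase_grid \<Rightarrow> real" where
  "Lv g = vmax g - vmin g"

definition vpt :: "phase_grid \<Rightarrow> nat \<Rightarrow> real" where
  "vpt g q = vmin g + (real q - 1/2) * dv g"


definition inner_x :: "phase_grid \<Rightarrow> grid_fun \<Rightarrow> grid_fun \<Rightarrow> real" where
  "inner_x g \<phi> \<psi> = (\<Sum>p = 1..Nx g. \<phi> p * \<psi> p * dx g)"

definition inner_v :: "phase_grid \<Rightarrow> grid_fun \<Rightarrow> grid_fun \<Rightarrow> real" where
  "inner_v g \<phi> \<psi> = (\<Sum>q = 1..Nv g. \<phi> q * \<psi> q * dv g)"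

definition inner_xv :: "phase_grid \<Rightarrow> phase_fun \<Rightarrow> phase_fun \<Rightarrow> real" where
  "inner_xv g \<phi> \<psi> = (\<Sum>p = 1..Nx g. \<Sum>q = 1..Nv g. \<phi> p q * \<psi> p q * dx g * dv g)"

definition norm_x :: "phase_grid \<Rightarrow> grid_fun \<Rightarrow> real" where
  "norm_x g \<phi> = sqrt (inner_x g \<phi> \<phi>)"

definition norm_xv :: "phase_grid \<Rightarrow> phase_fun \<Rightarrow> real" where
  "norm_xv g \<phi> = sqrt (inner_xv g \<phi> \<phi>)"

definition density :: "phase_grid \<Rightarrow> phase_fun \<Rightarrow> grid_fun" where
  "density g f p = inner_v g (f p) (\<lambda>q. 1)"

definition orthonormal_x :: "phase_grid \<Rightarrow> nat \<Rightarrow> (nat \<Rightarrow> grid_fun) \<Rightarrow> bool" where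
  "orthonormal_x g r X \<longleftrightarrow>
     (\<forall>i\<in>{1..r}. \<forall>j\<in>{1..r}. inner_x g (X i) (X j) = (if i = j then 1 else 0))"

definition orthonormal_v :: "phase_grid \<Rightarrow> nat \<Rightarrow> (nat \<Rightarrow> grid_fun) \<Rightarrow> bool" where
  "orthonormal_v g r V \<longleftrightarrow>
     (\<forall>i\<in>{1..r}. \<forall>j\<in>{1..r}. inner_v g (V i) (V j) = (if i = j then 1 else 0))"

definition span_x :: "nat \<Rightarrow> (nat \<Rightarrow> grid_fun) \<Rightarrow> grid_fun set" where
  "span_x r X = {\<psi>. \<exists>c. \<psi> = (\<lambda>p. \<Sum>i = 1..r. c i * X i p)}"

definition proj_x :: "phase_grid \<Rightarrow> nat \<Rightarrow> (nat \<Rightarrow> grid_fun) \<Rightarrow> grid_fun \<Rightarrow> grid_fun" where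
  "proj_x g r X \<phi> =
     (THE \<psi>. \<psi> \<in> span_x r X \<and> (\<forall>\<chi>\<in>span_x r X. inner_x g (\<lambda>p. \<phi> p - \<psi> p) \<chi> = 0))"

definition proj_X :: "phase_grid \<Rightarrow> nat \<Rightarrow> (nat \<Rightarrow> grid_fun) \<Rightarrow> phase_fun \<Rightarrow> phase_fun" where
  "proj_X g r X f p q = proj_x g r X (\<lambda>p'. f p' q) p"


text \<open>The factor in front of the exponential is the unique \<open>c\<^sub>p > 0\<close> that gives unit discrete
  mass in every row.\<close>

definition maxwellian :: "phase_grid \<Rightarrow> grid_fun \<Rightarrow> phase_fun" where
  "maxwellian g E p q =
     (1 / (\<Sum>q' = 1..Nv g. exp (- (vpt g q' - E p)\<^sup>2 / 2) * dv g)) * exp (- (vpt g q - E p)\<^sup>2 / 2)"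

text \<open>In the half-point quantities below, index \<open>q\<close> stands for \<open>q + 1/2\<close>.\<close>

definition maxwellian_half :: "phase_grid \<Rightarrow> grid_fun \<Rightarrow> phase_fun" where
  "maxwellian_half g E p q = sqrt (maxwellian g E p q * maxwellian g E p (q + 1))"

definition flux :: "phase_grid \<Rightarrow> grid_fun \<Rightarrow> phase_fun \<Rightarrow> phase_fun" where
  "flux g E f p q =
     (if q \<in> {1..Nv g - 1}
      then maxwellian_half g E p q *
             ((f p (q + 1) / maxwellian g E p (q + 1) - f p q / maxwellian g E p q) / dv g)
      else 0)"

definition fokker_planck :: "phase_grid \<Rightarrow> grid_fun \<Rightarrow> phase_fun \<Rightarrow> phase_fun" where
  "fokker_planck g E f p q = (1 / dv g) * (flux g E f p q - flux g E f p (q - 1))"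


definition M_min :: "phase_grid \<Rightarrow> grid_fun \<Rightarrow> real" where
  "M_min g E = Min ((\<lambda>(p, q). maxwellian_half g E p q) ` ({1..Nx g} \<times> {1..Nv g - 1}))"

definition M_max :: "phase_grid \<Rightarrow> grid_fun \<Rightarrow> real" where
  "M_max g E =
     max (Max ((\<lambda>(p, q). maxwellian g E p q) ` ({1..Nx g} \<times> {1..Nv g})))
         (Max ((\<lambda>(p, q). maxwellian_half g E p q) ` ({1..Nx g} \<times> {1..Nv g - 1})))"

definition lambda_N :: "phase_grid \<Rightarrow> real" where
  "lambda_N g = 4 / (dv g)\<^sup>2 * (sin (pi / (2 * real (Nv g))))\<^sup>2"

definition gamma_h :: "phase_grid \<Rightarrow> grid_fun \<Rightarrow> real" where
  "gamma_h g E = M_min g E * lambda_N g / (1 + sqrt (Lv g * M_max g E))\<^sup>2"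

definition beta :: "phase_grid \<Rightarrow> grid_fun \<Rightarrow> grid_fun" where
  "beta g E p = exp (- (dv g / 2) * E p)"

definition beta_bar :: "phase_grid \<Rightarrow> grid_fun \<Rightarrow> real" where
  "beta_bar g E = 1 / real (Nx g) * (\<Sum>p = 1..Nx g. beta g E p)"

definition beta_dev :: "phase_grid \<Rightarrow> grid_fun \<Rightarrow> real" where
  "beta_dev g E = Max ((\<lambda>p. \<bar>beta g E p - beta_bar g E\<bar>) ` {1..Nx g})"

definition C_beta :: "phase_grid \<Rightarrow> grid_fun \<Rightarrow> real" where
  "C_beta g E = Max ((\<lambda>p. inverse (beta g E p * beta_bar g E)) ` {1..Nx g})"

definition alpha_half :: "phase_grid \<Rightarrow> nat \<Rightarrow> real" where
  "alpha_half g q = exp (dv g / 4 * (vpt g q + vpt g (q + 1)))"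

definition alpha_max :: "phase_grid \<Rightarrow> real" where
  "alpha_max g = Max (alpha_half g ` {1..Nv g - 1})"

definition alpha_min :: "phase_grid \<Rightarrow> real" where
  "alpha_min g = Min (alpha_half g ` {1..Nv g - 1})"

definition kappa_h :: "phase_grid \<Rightarrow> grid_fun \<Rightarrow> real" where
  "kappa_h g E =
     beta_dev g E *
       (2 * alpha_max g / (dv g)\<^sup>2 + C_beta g E * (2 / (alpha_min g * (dv g)\<^sup>2)))"

definition Theta :: "phase_grid \<Rightarrow> grid_fun \<Rightarrow> real" where
  "Theta g E = gamma_h g E / (gamma_h g E - kappa_h g E * M_max g E)"


text \<open>Discrete advection operators enter only as linear operators on the space of phase-space grid
  functions; the last conjunct says that the operator does not see values outside the grid.\<close>

definition linear_grid_operator :: "phase_grid \<Rightarrow> (phase_fun \<Rightarrow> phase_fun) \<Rightarrow> bool" where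
  "linear_grid_operator g A \<longleftrightarrow>
     (\<forall>f h. \<forall>p\<in>{1..Nx g}. \<forall>q\<in>{1..Nv g}. A (\<lambda>p q. f p q + h p q) p q = A f p q + A h p q) \<and>
     (\<forall>c f. \<forall>p\<in>{1..Nx g}. \<forall>q\<in>{1..Nv g}. A (\<lambda>p q. c * f p q) p q = c * A f p q) \<and>
     (\<forall>f h. (\<forall>p\<in>{1..Nx g}. \<forall>q\<in>{1..Nv g}. f p q = h p q) \<longrightarrow>
            (\<forall>p\<in>{1..Nx g}. \<forall>q\<in>{1..Nv g}. A f p q = A h p q))"

text \<open>The factors produced in one time step: \<open>X\<^sup>n, S\<^sup>n, V\<^sup>n\<close>, the K-step output \<open>K\<^sup>(\<^sup>1\<^sup>)\<close> with its
  QR factors \<open>X\<^sup>n\<^sup>+\<^sup>1, S\<^sup>(\<^sup>1\<^sup>)\<close>, the S-step output \<open>S\<^sup>(\<^sup>2\<^sup>)\<close> and the L-step output \<open>L\<^sup>n\<^sup>+\<^sup>1\<close>.\<close>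

record imex_data =
  X_old :: "nat \<Rightarrow> grid_fun"
  S_old :: "nat \<Rightarrow> nat \<Rightarrow> real"
  V_old :: "nat \<Rightarrow> grid_fun"
  K_one :: "nat \<Rightarrow> grid_fun"
  X_new :: "nat \<Rightarrow> grid_fun"
  S_one :: "nat \<Rightarrow> nat \<Rightarrow> real"
  S_two :: "nat \<Rightarrow> nat \<Rightarrow> real"
  L_new :: "nat \<Rightarrow> grid_fun"

definition lowrank ::
    "nat \<Rightarrow> (nat \<Rightarrow> grid_fun) \<Rightarrow> (nat \<Rightarrow> nat \<Rightarrow> real) \<Rightarrow> (nat \<Rightarrow> grid_fun) \<Rightarrow> phase_fun" where
  "lowrank r X S V p q = (\<Sum>i = 1..r. \<Sum>j = 1..r. X i p * S i j * V j q)"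

definition f_old :: "nat \<Rightarrow> imex_data \<Rightarrow> phase_fun" where
  "f_old r d = lowrank r (X_old d) (S_old d) (V_old d)"

definition K_old :: "nat \<Rightarrow> imex_data \<Rightarrow> nat \<Rightarrow> grid_fun" where
  "K_old r d j p = (\<Sum>i = 1..r. X_old d i p * S_old d i j)"

definition L_two :: "nat \<Rightarrow> imex_data \<Rightarrow> nat \<Rightarrow> grid_fun" where
  "L_two r d i q = (\<Sum>j = 1..r. S_two d i j * V_old d j q)"

definition f_two :: "nat \<Rightarrow> imex_data \<Rightarrow> phase_fun" where
  "f_two r d p q = (\<Sum>i = 1..r. X_new d i p * L_two r d i q)"

definition f_new :: "nat \<Rightarrow> imex_data \<Rightarrow> phase_fun" where
  "f_new r d p q = (\<Sum>i = 1..r. X_new d i p * L_new d i q)"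

definition K_step ::
    "phase_grid \<Rightarrow> (phase_fun \<Rightarrow> phase_fun) \<Rightarrow> grid_fun \<Rightarrow> real \<Rightarrow> real \<Rightarrow> nat \<Rightarrow> imex_data \<Rightarrow> bool" where
  "K_step g A E dt \<epsilon> r d \<longleftrightarrow>
     (let f1 = (\<lambda>p q. \<Sum>j = 1..r. K_one d j p * V_old d j q) in
      \<forall>j\<in>{1..r}. \<forall>p\<in>{1..Nx g}.
        (K_one d j p - K_old r d j p) / dt =
          inner_v g (A (f_old r d) p) (V_old d j)
          + 1 / \<epsilon> * inner_v g (fokker_planck g E f1 p) (V_old d j))"

definition QR_step :: "phase_grid \<Rightarrow> nat \<Rightarrow> imex_data \<Rightarrow> bool" where
  "QR_step g r d \<longleftrightarrow>
     orthonormal_x g r (X_new d) \<and>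
     (\<forall>i\<in>{1..r}. \<forall>j\<in>{1..r}. j < i \<longrightarrow> S_one d i j = 0) \<and>
     (\<forall>j\<in>{1..r}. \<forall>p\<in>{1..Nx g}. K_one d j p = (\<Sum>i = 1..r. X_new d i p * S_one d i j))"

definition S_step ::
    "phase_grid \<Rightarrow> (phase_fun \<Rightarrow> phase_fun) \<Rightarrow> grid_fun \<Rightarrow> real \<Rightarrow> real \<Rightarrow> nat \<Rightarrow> imex_data \<Rightarrow> bool" where
  "S_step g A E dt \<epsilon> r d \<longleftrightarrow>
     (let f1 = lowrank r (X_new d) (S_one d) (V_old d) in
      \<forall>i\<in>{1..r}. \<forall>j\<in>{1..r}.
        (S_two d i j - S_one d i j) / dt =
          - inner_xv g (A f1) (\<lambda>p q. X_new d i p * V_old d j q)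
          - 1 / \<epsilon> * inner_xv g (fokker_planck g E f1) (\<lambda>p q. X_new d i p * V_old d j q))"

definition L_step ::
    "phase_grid \<Rightarrow> (phase_fun \<Rightarrow> phase_fun) \<Rightarrow> grid_fun \<Rightarrow> real \<Rightarrow> real \<Rightarrow> nat \<Rightarrow> imex_data \<Rightarrow> bool" where
  "L_step g A E dt \<epsilon> r d \<longleftrightarrow>
     (\<forall>i\<in>{1..r}. \<forall>q\<in>{1..Nv g}.
        (L_new d i q - L_two r d i q) / dt =
          inner_x g (\<lambda>p. A (f_two r d) p q) (X_new d i)
          + 1 / \<epsilon> * inner_x g (\<lambda>p. fokker_planck g E (f_new r d) p q) (X_new d i))"

definition imex_step ::
    "phase_grid \<Rightarrow> (phase_fun \<Rightarrow> phase_fun) \<Rightarrow> grid_fun \<Rightarrow> real \<Rightarrow> real \<Rightarrow> nat \<Rightarrow> imex_data \<Rightarrow> bool" where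
  "imex_step g A E dt \<epsilon> r d \<longleftrightarrow>
     orthonormal_x g r (X_old d) \<and> orthonormal_v g r (V_old d) \<and>
     K_step g A E dt \<epsilon> r d \<and> QR_step g r d \<and> S_step g A E dt \<epsilon> r d \<and> L_step g A E dt \<epsilon> r d"

definition G_new ::
    "phase_grid \<Rightarrow> (phase_fun \<Rightarrow> phase_fun) \<Rightarrow> real \<Rightarrow> nat \<Rightarrow> imex_data \<Rightarrow> phase_fun" where
  "G_new g A dt r d p q =
     (f_new r d p q - f_two r d p q) / dt - proj_X g r (X_new d) (A (f_two r d)) p q"

end

theory Submission
  imports Defs "HOL-Analysis.L2_Norm" "HOL-Analysis.Convex"
begin

text \<open>
  Write \<open>\<L>\<close> for the discrete Fokker--Planck operator, \<open>P\<close> for the projector onto the span of the new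
  spatial basis and \<open>f\<close> for the result of the L-step.

  The L-step solves the stiff equation only after projection: it says \<open>P \<L> f = \<epsilon> G\<close>
  (\<open>L_step_proj_fokker_planck\<close>), and nothing about \<open>(1 - P) \<L> f\<close>. That part would vanish if \<open>\<L>\<close> acted
  in the same way in every row, because the columns of \<open>f\<close> lie in the range of \<open>P\<close>. Neighbouring values
  of the Maxwellian have the ratio \<open>(alpha * beta)\<^sup>2\<close>, where \<open>alpha\<close> depends on \<open>q\<close> and \<open>beta\<close> on \<open>p\<close> only,
  so \<open>\<L> = beta U - D / beta\<close> with operators \<open>U\<close>, \<open>D\<close> that act in \<open>v\<close> alone (\<open>fokker_planck_split\<close>).
  Freezing \<open>beta\<close> at its average gives an operator that commutes with \<open>P\<close>, and the remainder has norm at most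
  \<open>kappa_h\<close>. Hence \<open>norm (\<L> f) \<le> \<epsilon> * norm G + kappa_h * norm f\<close>
  (\<open>fokker_planck_le_proj_plus_fluctuation\<close>).

  In the other direction, \<open>- \<L>\<close> is coercive on grid functions of zero density, by a Poincare inequality for the
  relative density \<open>f / M\<close>; this bounds \<open>f - \<rho> M\<close> by \<open>M_max / gamma_h * norm (\<L> f)\<close>
  (\<open>maxwellian_deviation_le\<close>). Splitting \<open>f = (f - \<rho> M) + \<rho> M\<close> in the first estimate, the contribution
  of \<open>f - \<rho> M\<close> is at most \<open>kappa_h * M_max / gamma_h * norm (\<L> f)\<close>, which the small-fluctuation
  condition allows to be absorbed on the left. This gives the bound on \<open>\<L> f\<close>, and coercivity once more gives
  the bound on \<open>f - \<rho> M\<close>.\<close>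

section \<open>Discrete Poincare inequality\<close>

text \<open>The constant is the first eigenvalue of the discrete Dirichlet Laplacian on \<open>{0..N}\<close>, with
  positive eigenvector \<open>s k = sin (k \<pi> / N)\<close>. Comparing \<open>w\<close> with \<open>s\<close> cell by cell (Picone's
  inequality) gives a sum that telescopes by the three-term recurrence of \<open>s\<close>, so the sharp constant
  is obtained without diagonalising the Laplacian.\<close>

lemma dirichlet_inequality:
  fixes w :: "nat \<Rightarrow> real"
  assumes N: "1 \<le> N" and w0: "w 0 = 0" and wN: "w N = 0"
  shows "4 * (sin (pi / (2 * real N)))\<^sup>2 * (\<Sum>k = 1..N - 1. (w k)\<^sup>2)
           \<le> (\<Sum>k<N. (w (Suc k) - w k)\<^sup>2)"
proof (cases "N = 1")
  case True
  then show ?thesis by simp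
next
  case False
  then have N2: "2 \<le> N" using N by simp
  define \<theta> where "\<theta> = pi / real N"
  define l where "l = 4 * (sin (pi / (2 * real N)))\<^sup>2"
  define s where "s k = sin (real k * \<theta>)" for k
  have l: "l = 2 - 2 * cos \<theta>"
    using cos_double_sin[of "\<theta> / 2"] by (simp add: l_def \<theta>_def field_simps)
  have s_pos: "0 < s k" if "1 \<le> k" "k < N" for k
    unfolding s_def
  proof (rule sin_gt_zero)
    show "0 < real k * \<theta>" using that by (simp add: \<theta>_def)
    have "real k * \<theta> < real N * \<theta>"
      using that by (intro mult_strict_right_mono) (auto simp: \<theta>_def)
    then show "real k * \<theta> < pi" using N by (simp add: \<theta>_def)
  qed
  have s_rec: "s (Suc (Suc k)) + s k = (2 - l) * s (Suc k)" for k
  proof -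
    have "s (Suc (Suc k)) = sin (real (Suc k) * \<theta> + \<theta>)" "s k = sin (real (Suc k) * \<theta> - \<theta>)"
      by (simp_all add: s_def algebra_simps)
    then show ?thesis
      unfolding l by (simp add: s_def sin_add sin_diff)
  qed
  have sN: "s N = 0" using N by (simp add: s_def \<theta>_def)
  have ratio: "1 - s m / s (Suc m) = l - 1 + s (Suc (Suc m)) / s (Suc m)"
    if "Suc m < N" for m
  proof -
    have "s (Suc (Suc m)) / s (Suc m) + s m / s (Suc m) = 2 - l"
      using s_rec[of m] s_pos[of "Suc m"] that by (simp add: add_divide_distrib[symmetric])
    then show ?thesis by linarith
  qed
  \<comment> \<open>Picone's inequality on one cell, with \<open>a, b\<close> for values of \<open>w\<close> and \<open>x, y\<close> for values of \<open>s\<close>\<close>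
  have picone: "a\<^sup>2 * (1 - y / x) + b\<^sup>2 * (1 - x / y) \<le> (b - a)\<^sup>2"
    if "0 < x" "0 < y" for a b x y :: real
  proof -
    have "0 \<le> (a * y - b * x)\<^sup>2 / (x * y)" using that by simp
    also have "\<dots> = (b - a)\<^sup>2 - (a\<^sup>2 * (1 - y / x) + b\<^sup>2 * (1 - x / y))"
      using that by (simp add: field_simps power2_eq_square)
    finally show ?thesis by simp
  qed
  \<comment> \<open>Adding up the cells: the recurrence of \<open>s\<close> turns the coefficient of each interior \<open>(w k)\<^sup>2\<close>
    into \<open>l\<close>; only the last coefficient is still incomplete.\<close>
  have part: "l * (\<Sum>k = 1..m. (w k)\<^sup>2) + (w (Suc m))\<^sup>2 * (1 - s m / s (Suc m))
                \<le> (\<Sum>k<Suc m. (w (Suc k) - w k)\<^sup>2)" if "Suc m < N" for m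
    using that
  proof (induction m)
    case 0
    then show ?case by (simp add: w0 s_def)
  next
    case (Suc m)
    have "(w (Suc m))\<^sup>2 * (1 - s (Suc (Suc m)) / s (Suc m))
            + (w (Suc (Suc m)))\<^sup>2 * (1 - s (Suc m) / s (Suc (Suc m)))
          \<le> (w (Suc (Suc m)) - w (Suc m))\<^sup>2"
      using Suc.prems by (intro picone s_pos) auto
    moreover have "(w (Suc m))\<^sup>2 * (1 - s m / s (Suc m))
        = l * (w (Suc m))\<^sup>2 - (w (Suc m))\<^sup>2 * (1 - s (Suc (Suc m)) / s (Suc m))"
      using Suc.prems by (subst ratio) (auto simp: algebra_simps)
    ultimately show ?case using Suc by (simp add: algebra_simps)
  qed
  obtain m where m: "N = Suc (Suc m)" using N2 by (metis One_nat_def Suc_le_D numeral_2_eq_2 Suc_le_mono)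
  have "(w (Suc m))\<^sup>2 * (1 - s m / s (Suc m)) + (w N - w (Suc m))\<^sup>2 = l * (w (Suc m))\<^sup>2"
    using sN m wN by (subst ratio) (auto simp: algebra_simps)
  with part[of m] m show ?thesis
    unfolding l_def[symmetric] by (simp add: algebra_simps)
qed

text \<open>The Neumann case follows from the Dirichlet case by duality: the partial sums \<open>w\<close> of a mean-zero
  \<open>u\<close> vanish at both ends and have \<open>u\<close> as their differences, so summation by parts bounds
  \<open>\<Sum>u\<^sup>2\<close> by the differences of \<open>u\<close> times \<open>w\<close>, and \<open>w\<close> is controlled by \<open>u\<close>.
  The constant is \<open>lambda_N\<close> times the squared mesh size.\<close>

lemma poincare_inequality:
  fixes u :: "nat \<Rightarrow> real"
  assumes N: "1 \<le> N" and mean: "(\<Sum>q = 1..N. u q) = 0"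
  shows "4 * (sin (pi / (2 * real N)))\<^sup>2 * (\<Sum>q = 1..N. (u q)\<^sup>2)
           \<le> (\<Sum>q = 1..N - 1. (u (q + 1) - u q)\<^sup>2)"
proof -
  define l where "l = 4 * (sin (pi / (2 * real N)))\<^sup>2"
  define w where "w k = (\<Sum>q = 1..k. u q)" for k
  define U where "U = (\<Sum>q = 1..N. (u q)\<^sup>2)"
  define D where "D = (\<Sum>q = 1..N - 1. (u (q + 1) - u q)\<^sup>2)"
  define W where "W = (\<Sum>k = 1..N - 1. (w k)\<^sup>2)"
  have l0: "0 \<le> l" by (simp add: l_def)
  have "U = (\<Sum>k<N. (w (Suc k) - w k)\<^sup>2)"
    unfolding U_def by (simp add: w_def sum.atLeast1_atMost_eq)
  then have lW: "l * W \<le> U"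
    using dirichlet_inequality[of N w] N mean by (simp add: l_def W_def w_def)
  have abel: "(\<Sum>q = 1..m. (u q)\<^sup>2) = u (Suc m) * w m - (\<Sum>q = 1..m. (u (q + 1) - u q) * w q)" for m
  proof (induction m)
    case 0
    then show ?case by (simp add: w_def)
  next
    case (Suc m)
    then show ?case by (simp add: w_def power2_eq_square algebra_simps)
  qed
  obtain m where m: "N = Suc m" using N by (metis Suc_le_D One_nat_def)
  have "U = u N * w N - (\<Sum>q = 1..m. (u (q + 1) - u q) * w q)"
    unfolding U_def m using abel[of m] by (simp add: w_def power2_eq_square algebra_simps)
  then have U: "U = - (\<Sum>q = 1..N - 1. (u (q + 1) - u q) * w q)"
    using mean m by (simp add: w_def)
  have "U\<^sup>2 \<le> D * W"
    unfolding U D_def W_def power2_minus by (rule Cauchy_Schwarz_ineq_sum)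
  then have "l * U\<^sup>2 \<le> D * (l * W)" using l0 by (metis mult_left_mono mult.left_commute)
  also have "\<dots> \<le> D * U" using lW by (intro mult_left_mono) (auto simp: D_def sum_nonneg)
  finally have "(l * U) * U \<le> D * U" by (simp add: power2_eq_square mult.assoc)
  moreover have "0 \<le> U" by (simp add: U_def sum_nonneg)
  ultimately have "l * U \<le> D"
    by (cases "U = 0") (auto simp: D_def sum_nonneg)
  then show ?thesis by (simp add: l_def U_def D_def)
qed

section \<open>Grid norms\<close>

lemma dv_pos: "valid_grid g \<Longrightarrow> 0 < dv g"
  by (simp add: valid_grid_def dv_def)

lemma dx_pos: "valid_grid g \<Longrightarrow> 0 < dx g"
  by (simp add: valid_grid_def dx_def)

lemma Lv_eq: "valid_grid g \<Longrightarrow> Lv g = real (Nv g) * dv g"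
  by (simp add: valid_grid_def Lv_def dv_def)

lemma norm_xv_L2:
  assumes "valid_grid g"
  shows "norm_xv g f = sqrt (dx g * dv g) * L2_set (\<lambda>(p, q). f p q) ({1..Nx g} \<times> {1..Nv g})"
proof -
  have "inner_xv g f f = dx g * dv g * (\<Sum>(p, q)\<in>{1..Nx g} \<times> {1..Nv g}. (f p q)\<^sup>2)"
    unfolding inner_xv_def sum.cartesian_product[symmetric] sum_distrib_left
    by (simp add: power2_eq_square mult_ac)
  then show ?thesis
    by (simp add: norm_xv_def L2_set_def real_sqrt_mult case_prod_unfold)
qed

lemma norm_xv_nonneg: "valid_grid g \<Longrightarrow> 0 \<le> norm_xv g f"
  using dx_pos dv_pos by (simp add: norm_xv_L2 less_imp_le)

lemma norm_xv_power2:
  assumes "valid_grid g"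
  shows "(norm_xv g f)\<^sup>2 = inner_xv g f f"
  unfolding norm_xv_def using dx_pos[OF assms] dv_pos[OF assms]
  by (auto intro!: real_sqrt_pow2 sum_nonneg simp: inner_xv_def)

lemma norm_xv_triangle:
  assumes "valid_grid g"
  shows "norm_xv g (\<lambda>p q. f p q + h p q) \<le> norm_xv g f + norm_xv g h"
proof -
  have "L2_set (\<lambda>(p, q). f p q + h p q) S \<le> L2_set (\<lambda>(p, q). f p q) S + L2_set (\<lambda>(p, q). h p q) S" for S
    using L2_set_triangle_ineq[of "\<lambda>(p, q). f p q" "\<lambda>(p, q). h p q" S] by (simp add: case_prod_unfold)
  then show ?thesis
    unfolding norm_xv_L2[OF assms] distrib_left[symmetric]
    by (intro mult_left_mono) (use dx_pos[OF assms] dv_pos[OF assms] in auto)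
qed

lemma norm_xv_mono:
  assumes "valid_grid g" and "0 \<le> c"
    and le: "\<And>p q. p \<in> {1..Nx g} \<Longrightarrow> q \<in> {1..Nv g} \<Longrightarrow> \<bar>f p q\<bar> \<le> c * \<bar>h p q\<bar>"
  shows "norm_xv g f \<le> c * norm_xv g h"
proof -
  let ?S = "{1..Nx g} \<times> {1..Nv g}"
  have "L2_set (\<lambda>(p, q). f p q) ?S = L2_set (\<lambda>(p, q). \<bar>f p q\<bar>) ?S"
    by (simp add: L2_set_def case_prod_unfold)
  also have "\<dots> \<le> L2_set (\<lambda>(p, q). c * \<bar>h p q\<bar>) ?S"
    using le by (intro L2_set_mono) auto
  also have "\<dots> = c * L2_set (\<lambda>(p, q). h p q) ?S"
    using \<open>0 \<le> c\<close> L2_set_right_distrib[of c "\<lambda>(p, q). h p q" ?S]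
    by (simp add: L2_set_def case_prod_unfold power_mult_distrib)
  finally have "sqrt (dx g * dv g) * L2_set (\<lambda>(p, q). f p q) ?S
      \<le> sqrt (dx g * dv g) * (c * L2_set (\<lambda>(p, q). h p q) ?S)"
    using dx_pos[OF assms(1)] dv_pos[OF assms(1)] by (intro mult_left_mono) auto
  then show ?thesis
    by (simp add: norm_xv_L2[OF assms(1)] mult_ac)
qed

lemma norm_xv_cong:
  assumes "\<And>p q. p \<in> {1..Nx g} \<Longrightarrow> q \<in> {1..Nv g} \<Longrightarrow> f p q = h p q"
  shows "norm_xv g f = norm_xv g h"
  using assms unfolding norm_xv_def inner_xv_def by simp

lemma norm_xv_mono_rows:
  assumes g: "valid_grid g"
    and row: "\<And>p. (\<Sum>q = 1..Nv g. (f p q)\<^sup>2) \<le> (\<Sum>q = 1..Nv g. (h p q)\<^sup>2)"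
  shows "norm_xv g f \<le> norm_xv g h"
proof -
  have eq: "inner_xv g k k = dx g * dv g * (\<Sum>p = 1..Nx g. \<Sum>q = 1..Nv g. (k p q)\<^sup>2)" for k
    by (simp add: inner_xv_def sum_distrib_left power2_eq_square mult_ac)
  show ?thesis
    unfolding norm_xv_def eq using dx_pos[OF g] dv_pos[OF g]
    by (intro real_sqrt_le_mono mult_left_mono sum_mono row) auto
qed

lemma inner_xv_le_norms:
  assumes "valid_grid g"
  shows "\<bar>inner_xv g f h\<bar> \<le> norm_xv g f * norm_xv g h"
proof -
  let ?S = "{1..Nx g} \<times> {1..Nv g}"
  have "inner_xv g f h = dx g * dv g * (\<Sum>(p, q)\<in>?S. f p q * h p q)"
    unfolding inner_xv_def sum.cartesian_product[symmetric] sum_distrib_left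
    by (simp add: mult_ac)
  then have "\<bar>inner_xv g f h\<bar> \<le> dx g * dv g * (\<Sum>(p, q)\<in>?S. \<bar>f p q\<bar> * \<bar>h p q\<bar>)"
    using dx_pos[OF assms] dv_pos[OF assms]
    by (auto simp: abs_mult case_prod_unfold intro!: mult_left_mono order_trans[OF sum_abs])
  also have "\<dots> \<le> dx g * dv g * (L2_set (\<lambda>(p, q). f p q) ?S * L2_set (\<lambda>(p, q). h p q) ?S)"
    using L2_set_mult_ineq[of "\<lambda>(p, q). f p q" "\<lambda>(p, q). h p q" ?S] dx_pos[OF assms] dv_pos[OF assms]
    by (intro mult_left_mono) (auto simp: case_prod_unfold)
  also have "\<dots> = norm_xv g f * norm_xv g h"
    using dx_pos[OF assms] dv_pos[OF assms] by (simp add: norm_xv_L2[OF assms])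
  finally show ?thesis .
qed

section \<open>Coercivity of the discrete Fokker--Planck operator\<close>

lemma maxwellian_pos:
  assumes "valid_grid g"
  shows "0 < maxwellian g E p q"
proof -
  have "0 < (\<Sum>q' = 1..Nv g. exp (- (vpt g q' - E p)\<^sup>2 / 2) * dv g)"
    using assms dv_pos[OF assms] by (intro sum_pos) (auto simp: valid_grid_def)
  then show ?thesis by (simp add: maxwellian_def)
qed

lemma maxwellian_half_pos: "valid_grid g \<Longrightarrow> 0 < maxwellian_half g E p q"
  by (simp add: maxwellian_half_def maxwellian_pos)

lemma maxwellian_mass:
  assumes "valid_grid g"
  shows "(\<Sum>q = 1..Nv g. maxwellian g E p q * dv g) = 1"
proof -
  have "0 < (\<Sum>q' = 1..Nv g. exp (- (vpt g q' - E p)\<^sup>2 / 2) * dv g)"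
    using assms dv_pos[OF assms] by (intro sum_pos) (auto simp: valid_grid_def)
  then show ?thesis
    by (simp add: maxwellian_def sum_distrib_left[symmetric] mult.assoc sum_divide_distrib[symmetric])
qed

lemma maxwellian_le_M_max:
  assumes "p \<in> {1..Nx g}" "q \<in> {1..Nv g}"
  shows "maxwellian g E p q \<le> M_max g E"
proof -
  have "maxwellian g E p q \<le> Max ((\<lambda>(p, q). maxwellian g E p q) ` ({1..Nx g} \<times> {1..Nv g}))"
    using assms by (intro Max_ge) (auto intro!: image_eqI[of _ _ "(p, q)"])
  then show ?thesis by (simp add: M_max_def)
qed

lemma M_min_le:
  assumes "p \<in> {1..Nx g}" "q \<in> {1..Nv g - 1}"
  shows "M_min g E \<le> maxwellian_half g E p q"
  unfolding M_min_def using assms by (intro Min_le) (auto intro!: image_eqI[of _ _ "(p, q)"])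

lemma M_min_pos:
  assumes "valid_grid g"
  shows "0 < M_min g E"
  unfolding M_min_def using assms
  by (subst Min_gr_iff) (auto simp: maxwellian_half_pos valid_grid_def)

lemma M_max_pos:
  assumes "valid_grid g"
  shows "0 < M_max g E"
  using maxwellian_le_M_max[of 1 g 1 E] maxwellian_pos[OF assms, of E 1 1] assms
  by (auto simp: valid_grid_def)

lemma gamma_h_pos:
  assumes "valid_grid g"
  shows "0 < gamma_h g E"
proof -
  have "0 < sin (pi / (2 * real (Nv g)))"
    using assms by (intro sin_gt_zero) (auto simp: valid_grid_def field_simps)
  then have "0 < lambda_N g"
    using dv_pos[OF assms] by (simp add: lambda_N_def)
  moreover have "0 \<le> Lv g * M_max g E"
    using M_max_pos[OF assms, of E] assms by (simp add: Lv_def valid_grid_def less_imp_le)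
  then have "0 < 1 + sqrt (Lv g * M_max g E)"
    by (intro add_pos_nonneg) auto
  ultimately show ?thesis
    using M_min_pos[OF assms] by (simp add: gamma_h_def)
qed

text \<open>The Poincare inequality controls the deviation of \<open>h\<close> from its plain average \<open>a\<close>, whereas \<open>h\<close> is
  centred for the weight \<open>M\<close>. Then \<open>a\<close> is, up to sign, the \<open>M\<close>-mean of \<open>h - a\<close>, so it costs at most
  the norm of \<open>M\<close>, and unit mass gives \<open>\<Sum>M\<^sup>2 \<delta> \<le> m\<close>. This is the origin of the factor
  \<open>(1 + sqrt (Lv * M_max))\<^sup>2\<close> in \<open>gamma_h\<close>.\<close>

lemma sum_squares_le_of_weighted_mean_zero:
  fixes M h :: "nat \<Rightarrow> real"
  assumes N: "1 \<le> N" and \<delta>: "0 < \<delta>"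
    and M0: "\<And>q. q \<in> {1..N} \<Longrightarrow> 0 \<le> M q" and Mm: "\<And>q. q \<in> {1..N} \<Longrightarrow> M q \<le> m"
    and mass: "(\<Sum>q = 1..N. M q * \<delta>) = 1"
    and mean: "(\<Sum>q = 1..N. M q * h q) = 0"
  shows "(\<Sum>q = 1..N. (h q)\<^sup>2)
           \<le> (1 + sqrt (real N * \<delta> * m))\<^sup>2 * (\<Sum>q = 1..N. (h q - a)\<^sup>2)"
proof -
  let ?S = "{1..N}"
  define k where "k q = h q - a" for q
  have m0: "0 \<le> m" using M0[of 1] Mm[of 1] N by auto
  have "(\<Sum>q = 1..N. M q * k q * \<delta>) = (\<Sum>q = 1..N. M q * h q) * \<delta> - a * (\<Sum>q = 1..N. M q * \<delta>)"
    by (simp add: k_def sum_distrib_left sum_distrib_right sum_subtractf[symmetric] algebra_simps)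
  then have "(\<Sum>q = 1..N. M q * k q * \<delta>) = - a" using mean mass by simp
  then have a: "a = - (\<Sum>q = 1..N. M q * k q) * \<delta>" by (simp add: sum_distrib_right)
  have "(L2_set M ?S)\<^sup>2 \<le> m / \<delta>"
  proof -
    have "(L2_set M ?S)\<^sup>2 = (\<Sum>q = 1..N. M q * M q)"
      by (simp add: L2_set_def sum_nonneg power2_eq_square)
    also have "\<dots> \<le> (\<Sum>q = 1..N. m * M q)"
      using M0 Mm by (intro sum_mono mult_right_mono) auto
    also have "\<dots> = m / \<delta>"
      using mass \<delta> by (simp add: sum_distrib_left[symmetric] sum_distrib_right[symmetric] field_simps)
    finally show ?thesis .
  qed
  then have M_norm: "L2_set M ?S \<le> sqrt (m / \<delta>)" by (rule real_le_rsqrt)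
  have "\<bar>a\<bar> \<le> (\<Sum>q = 1..N. \<bar>M q\<bar> * \<bar>k q\<bar>) * \<delta>"
    using \<delta> unfolding a
    by (simp add: abs_mult) (rule order_trans[OF sum_abs], simp add: abs_mult)
  also have "\<dots> \<le> (L2_set M ?S * L2_set k ?S) * \<delta>"
    using \<delta> by (intro mult_right_mono L2_set_mult_ineq) auto
  also have "\<dots> \<le> (sqrt (m / \<delta>) * L2_set k ?S) * \<delta>"
    using \<delta> by (intro mult_right_mono M_norm) auto
  finally have "sqrt (real N) * \<bar>a\<bar> \<le> sqrt (real N) * ((sqrt (m / \<delta>) * L2_set k ?S) * \<delta>)"
    by (intro mult_left_mono) auto
  also have "\<dots> = sqrt (real N * \<delta> * m) * L2_set k ?S"
    using \<delta> real_sqrt_mult_self[of \<delta>] by (simp add: real_sqrt_mult real_sqrt_divide field_simps)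
  finally have const: "L2_set (\<lambda>_. a) ?S \<le> sqrt (real N * \<delta> * m) * L2_set k ?S"
    by (simp add: L2_set_def real_sqrt_mult)
  have "L2_set h ?S \<le> L2_set k ?S + L2_set (\<lambda>_. a) ?S"
    using L2_set_triangle_ineq[of k "\<lambda>_. a" ?S] by (simp add: k_def)
  also have "\<dots> \<le> (1 + sqrt (real N * \<delta> * m)) * L2_set k ?S"
    using const by (simp add: algebra_simps)
  finally have "(L2_set h ?S)\<^sup>2 \<le> ((1 + sqrt (real N * \<delta> * m)) * L2_set k ?S)\<^sup>2"
    by (rule power_mono) simp
  then show ?thesis
    by (simp add: power_mult_distrib L2_set_def sum_nonneg k_def)
qed

lemma fokker_planck_summation_by_parts:
  assumes g: "valid_grid g"
  shows "(\<Sum>q = 1..Nv g. fokker_planck g E f p q * h q * dv g)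
           = - (\<Sum>q = 1..Nv g - 1. flux g E f p q * (h (q + 1) - h q))"
proof -
  let ?J = "flux g E f p"
  have sbp: "(\<Sum>q = 1..m. (?J q - ?J (q - 1)) * h q)
      = ?J m * h (m + 1) - ?J 0 * h 1 - (\<Sum>q = 1..m. ?J q * (h (q + 1) - h q))" for m
    by (induction m) (auto simp: algebra_simps)
  obtain m where m: "Nv g = Suc m" using g by (cases "Nv g") (auto simp: valid_grid_def)
  have zero: "?J 0 = 0" "?J (Suc m) = 0" by (auto simp: flux_def m)
  show ?thesis
    using sbp[of "Suc m"] dv_pos[OF g] by (simp add: fokker_planck_def m zero)
qed

text \<open>In each row the Fokker--Planck operator acts as a weighted Neumann Laplacian in the relative density
  \<open>h = f / M\<close>: its Dirichlet form is at least \<open>M_min\<close> times the unweighted one, to which the Poincare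
  inequality applies. Vanishing density means that \<open>h\<close> has zero mean for the weight \<open>M\<close>.\<close>

lemma relative_density_coercive:
  assumes g: "valid_grid g" and p: "p \<in> {1..Nx g}" and mean: "density g f p = 0"
  shows "gamma_h g E * (\<Sum>q = 1..Nv g. (f p q / maxwellian g E p q)\<^sup>2 * dv g)
    \<le> - (\<Sum>q = 1..Nv g. fokker_planck g E f p q * (f p q / maxwellian g E p q) * dv g)"
proof -
  define M where "M = maxwellian g E p"
  define h where "h q = f p q / M q" for q
  define a where "a = (\<Sum>q = 1..Nv g. h q) / real (Nv g)"
  define c where "c = (1 + sqrt (Lv g * M_max g E))\<^sup>2"
  define s where "s = 4 * (sin (pi / (2 * real (Nv g))))\<^sup>2"
  define P where "P = (\<Sum>q = 1..Nv g. (h q - a)\<^sup>2)"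
  define D where "D = (\<Sum>q = 1..Nv g - 1. (h (q + 1) - h q)\<^sup>2)"
  have Nv: "1 \<le> Nv g" "0 < real (Nv g)" using g by (auto simp: valid_grid_def)
  have dv: "0 < dv g" by (rule dv_pos[OF g])
  have Mpos: "0 < M q" for q by (simp add: M_def maxwellian_pos[OF g])
  have "(\<Sum>q = 1..Nv g. M q * h q) * dv g = density g f p"
    using Mpos by (simp add: density_def inner_v_def h_def sum_distrib_right less_imp_neq[symmetric])
  then have mean': "(\<Sum>q = 1..Nv g. M q * h q) = 0"
    using mean dv by simp
  have "(\<Sum>q = 1..Nv g. (h q)\<^sup>2) \<le> (1 + sqrt (real (Nv g) * dv g * M_max g E))\<^sup>2 * P"
    unfolding P_def
    using Nv dv Mpos mean' maxwellian_mass[OF g, of E p] maxwellian_le_M_max[OF p]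
    by (intro sum_squares_le_of_weighted_mean_zero[where M = M]) (auto simp: M_def less_imp_le)
  then have 1: "(\<Sum>q = 1..Nv g. (h q)\<^sup>2) \<le> c * P" by (simp add: c_def Lv_eq[OF g])
  have "(\<Sum>q = 1..Nv g. h q - a) = 0"
    using Nv by (simp add: sum_subtractf a_def)
  from poincare_inequality[OF Nv(1) this] have 2: "s * P \<le> D"
    by (simp add: s_def P_def D_def)
  have "0 \<le> Lv g * M_max g E"
    using M_max_pos[OF g, of E] g by (simp add: Lv_def valid_grid_def less_imp_le)
  then have c0: "0 < c"
    unfolding c_def by (intro zero_less_power add_pos_nonneg) auto
  have gam: "gamma_h g E = M_min g E * s / (dv g)\<^sup>2 / c"
    by (simp add: gamma_h_def lambda_N_def s_def c_def)
  have mm: "0 \<le> M_min g E / dv g" using M_min_pos[OF g, of E] dv by (simp add: less_imp_le)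
  have "gamma_h g E * (\<Sum>q = 1..Nv g. (h q)\<^sup>2 * dv g)
      = M_min g E * s / dv g / c * (\<Sum>q = 1..Nv g. (h q)\<^sup>2)"
    using dv by (simp add: gam sum_distrib_right[symmetric] power2_eq_square)
  also have "\<dots> \<le> M_min g E * s / dv g / c * (c * P)"
    using c0 dv M_min_pos[OF g, of E] by (intro mult_left_mono 1) (auto simp: s_def)
  also have "\<dots> = M_min g E / dv g * (s * P)" using c0 by simp
  also have "\<dots> \<le> M_min g E / dv g * D" by (intro mult_left_mono 2 mm)
  also have "\<dots> = (\<Sum>q = 1..Nv g - 1. M_min g E * ((h (q + 1) - h q)\<^sup>2 / dv g))"
    by (simp add: D_def sum_distrib_left sum_divide_distrib)
  also have "\<dots> \<le> (\<Sum>q = 1..Nv g - 1. maxwellian_half g E p q * ((h (q + 1) - h q)\<^sup>2 / dv g))"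
    using dv M_min_le[OF p] by (intro sum_mono mult_right_mono) auto
  also have "\<dots> = (\<Sum>q = 1..Nv g - 1. flux g E f p q * (h (q + 1) - h q))"
    by (intro sum.cong) (auto simp: flux_def h_def M_def power2_eq_square)
  also have "\<dots> = - (\<Sum>q = 1..Nv g. fokker_planck g E f p q * h q * dv g)"
    unfolding fokker_planck_summation_by_parts[OF g] by simp
  finally show ?thesis by (simp add: h_def M_def)
qed

text \<open>Local Maxwellians have constant relative density in each row, hence no flux.\<close>

lemma fokker_planck_local_maxwellian:
  assumes g: "valid_grid g"
  shows "fokker_planck g E (\<lambda>p q. f p q - \<rho> p * maxwellian g E p q) = fokker_planck g E f"
proof -
  have "maxwellian g E p q \<noteq> 0" for p q using maxwellian_pos[OF g, of E p q] by simp
  then have "flux g E (\<lambda>p q. f p q - \<rho> p * maxwellian g E p q) = flux g E f"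
    by (intro ext) (simp add: flux_def diff_divide_distrib)
  then show ?thesis by (intro ext) (simp add: fokker_planck_def)
qed

text \<open>The deviation has zero density and the same image under the operator as \<open>f\<close>. Coercivity in its
  relative density \<open>h\<close> and Cauchy--Schwarz give \<open>gamma_h * norm h \<le> norm (fokker_planck f)\<close>; returning
  from \<open>h\<close> to the deviation costs the factor \<open>M_max\<close>.\<close>

lemma maxwellian_deviation_le:
  assumes g: "valid_grid g"
  shows "norm_xv g (\<lambda>p q. f p q - density g f p * maxwellian g E p q)
    \<le> M_max g E / gamma_h g E * norm_xv g (fokker_planck g E f)"
proof -
  define M where "M = maxwellian g E"
  define e where "e p q = f p q - density g f p * M p q" for p q
  define h where "h p q = e p q / M p q" for p q
  have Mpos: "0 < M p q" for p q by (simp add: M_def maxwellian_pos[OF g])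
  have gam: "0 < gamma_h g E" by (rule gamma_h_pos[OF g])
  have dx: "0 < dx g" by (rule dx_pos[OF g])
  have Le: "fokker_planck g E e = fokker_planck g E f"
    unfolding e_def M_def by (rule fokker_planck_local_maxwellian[OF g])
  have mean: "density g e p = 0" for p
  proof -
    have "density g e p = density g f p - density g f p * (\<Sum>q = 1..Nv g. M p q * dv g)"
      by (simp add: density_def inner_v_def e_def sum_subtractf sum_distrib_left left_diff_distrib mult.assoc)
    then show ?thesis using maxwellian_mass[OF g] by (simp add: M_def)
  qed
  have "gamma_h g E * (norm_xv g h)\<^sup>2 = (\<Sum>p = 1..Nx g. dx g * (gamma_h g E * (\<Sum>q = 1..Nv g. (h p q)\<^sup>2 * dv g)))"
    unfolding norm_xv_power2[OF g] by (simp add: inner_xv_def sum_distrib_left power2_eq_square mult_ac)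
  also have "\<dots> \<le> (\<Sum>p = 1..Nx g. dx g * - (\<Sum>q = 1..Nv g. fokker_planck g E e p q * h p q * dv g))"
    using relative_density_coercive[OF g _ mean, of _ E] dx
    by (intro sum_mono mult_left_mono) (auto simp: h_def M_def)
  also have "\<dots> = - inner_xv g (fokker_planck g E e) h"
    by (simp add: inner_xv_def sum_distrib_left sum_negf mult_ac)
  also have "\<dots> \<le> norm_xv g (fokker_planck g E f) * norm_xv g h"
    using inner_xv_le_norms[OF g, of "fokker_planck g E e" h] by (simp add: Le)
  finally have "(gamma_h g E * norm_xv g h) * norm_xv g h \<le> norm_xv g (fokker_planck g E f) * norm_xv g h"
    by (simp add: power2_eq_square mult.assoc)
  then have h: "gamma_h g E * norm_xv g h \<le> norm_xv g (fokker_planck g E f)"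
    using norm_xv_nonneg[OF g, of h] norm_xv_nonneg[OF g, of "fokker_planck g E f"]
    by (cases "norm_xv g h = 0") auto
  have "norm_xv g e \<le> M_max g E * norm_xv g h"
  proof (rule norm_xv_mono[OF g])
    fix p q assume pq: "p \<in> {1..Nx g}" "q \<in> {1..Nv g}"
    have "\<bar>e p q\<bar> = M p q * \<bar>h p q\<bar>" using Mpos[of p q] by (simp add: h_def abs_mult)
    also have "\<dots> \<le> M_max g E * \<bar>h p q\<bar>"
      using maxwellian_le_M_max[OF pq] by (intro mult_right_mono) (auto simp: M_def)
    finally show "\<bar>e p q\<bar> \<le> M_max g E * \<bar>h p q\<bar>" .
  qed (use M_max_pos[OF g] in \<open>simp add: less_imp_le\<close>)
  also have "\<dots> \<le> M_max g E * (norm_xv g (fokker_planck g E f) / gamma_h g E)"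
    using h gam M_max_pos[OF g, of E] by (intro mult_left_mono) (auto simp: field_simps)
  finally show ?thesis by (simp add: e_def[abs_def] M_def)
qed

lemma norm_xv_local_maxwellian_le:
  assumes g: "valid_grid g"
  shows "norm_xv g (\<lambda>p q. \<rho> p * maxwellian g E p q) \<le> M_max g E * sqrt (Lv g) * norm_x g \<rho>"
proof -
  have "norm_xv g (\<lambda>p q. \<rho> p * maxwellian g E p q) \<le> M_max g E * norm_xv g (\<lambda>p q. \<rho> p)"
  proof (rule norm_xv_mono[OF g])
    fix p q assume pq: "p \<in> {1..Nx g}" "q \<in> {1..Nv g}"
    have "\<bar>\<rho> p * maxwellian g E p q\<bar> = maxwellian g E p q * \<bar>\<rho> p\<bar>"
      using maxwellian_pos[OF g, of E p q] by (simp add: abs_mult)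
    also have "\<dots> \<le> M_max g E * \<bar>\<rho> p\<bar>"
      by (intro mult_right_mono maxwellian_le_M_max pq) simp
    finally show "\<bar>\<rho> p * maxwellian g E p q\<bar> \<le> M_max g E * \<bar>\<rho> p\<bar>" .
  qed (use M_max_pos[OF g] in \<open>simp add: less_imp_le\<close>)
  also have "norm_xv g (\<lambda>p q. \<rho> p) = sqrt (Lv g) * norm_x g \<rho>"
    by (simp add: norm_xv_def norm_x_def inner_xv_def inner_x_def Lv_eq[OF g]
        real_sqrt_mult[symmetric] sum_distrib_left mult_ac)
  finally show ?thesis by (simp add: mult.assoc)
qed

section \<open>The spatial projector and the L-step\<close>

text \<open>The explicit form of the orthogonal projection for an orthonormal family.\<close>

definition expansion :: "phase_grid \<Rightarrow> nat \<Rightarrow> (nat \<Rightarrow> grid_fun) \<Rightarrow> grid_fun \<Rightarrow> grid_fun" where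
  "expansion g r X \<phi> p = (\<Sum>i = 1..r. inner_x g \<phi> (X i) * X i p)"

lemma expansion_in_span: "expansion g r X \<phi> \<in> span_x r X"
  unfolding span_x_def expansion_def[abs_def]
  by (intro CollectI exI[of _ "\<lambda>i. inner_x g \<phi> (X i)"] refl)

lemma inner_x_commute: "inner_x g \<phi> \<psi> = inner_x g \<psi> \<phi>"
  by (simp add: inner_x_def mult.commute)

lemma inner_x_diff: "inner_x g (\<lambda>p. \<phi> p - \<psi> p) \<chi> = inner_x g \<phi> \<chi> - inner_x g \<psi> \<chi>"
  by (simp add: inner_x_def sum_subtractf[symmetric] algebra_simps)

lemma inner_x_sum: "inner_x g (\<lambda>p. \<Sum>i = 1..r. c i * X i p) \<chi> = (\<Sum>i = 1..r. c i * inner_x g (X i) \<chi>)"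
  unfolding inner_x_def sum_distrib_left sum_distrib_right
  by (subst sum.swap) (simp add: mult_ac)

lemma inner_x_orthonormal_sum:
  assumes "orthonormal_x g r X" "j \<in> {1..r}"
  shows "inner_x g (\<lambda>p. \<Sum>i = 1..r. c i * X i p) (X j) = c j"
proof -
  have "inner_x g (\<lambda>p. \<Sum>i = 1..r. c i * X i p) (X j) = (\<Sum>i = 1..r. if i = j then c i else 0)"
    unfolding inner_x_sum using assms by (intro sum.cong) (auto simp: orthonormal_x_def)
  then show ?thesis using assms(2) by simp
qed

lemma expansion_residual_orthogonal:
  assumes "orthonormal_x g r X" "\<chi> \<in> span_x r X"
  shows "inner_x g (\<lambda>p. \<phi> p - expansion g r X \<phi> p) \<chi> = 0"
proof -
  obtain c where c: "\<chi> = (\<lambda>p. \<Sum>i = 1..r. c i * X i p)"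
    using assms(2) by (auto simp: span_x_def)
  have "inner_x g (X j) (\<lambda>p. \<phi> p - expansion g r X \<phi> p) = 0" if "j \<in> {1..r}" for j
    using inner_x_orthonormal_sum[OF assms(1) that]
    by (simp add: inner_x_commute[of g "X j"] inner_x_diff expansion_def)
  then show ?thesis
    unfolding inner_x_commute[of g "\<lambda>p. \<phi> p - expansion g r X \<phi> p"] c inner_x_sum
    by (intro sum.neutral) simp
qed

text \<open>The elements of the span are functions on all indices, while the inner product sees only the grid;
  uniqueness therefore comes from comparing coefficients, which orthonormality determines.\<close>

lemma proj_x_eq_expansion:
  assumes "orthonormal_x g r X"
  shows "proj_x g r X \<phi> = expansion g r X \<phi>"
  unfolding proj_x_def
proof (rule the_equality)
  show "expansion g r X \<phi> \<in> span_x r X \<and>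
      (\<forall>\<chi>\<in>span_x r X. inner_x g (\<lambda>p. \<phi> p - expansion g r X \<phi> p) \<chi> = 0)"
    using expansion_in_span expansion_residual_orthogonal[OF assms] by blast
next
  fix \<psi> assume \<psi>: "\<psi> \<in> span_x r X \<and> (\<forall>\<chi>\<in>span_x r X. inner_x g (\<lambda>p. \<phi> p - \<psi> p) \<chi> = 0)"
  then obtain c where c: "\<psi> = (\<lambda>p. \<Sum>i = 1..r. c i * X i p)"
    by (auto simp: span_x_def)
  have "c j = inner_x g \<phi> (X j)" if j: "j \<in> {1..r}" for j
  proof -
    have "X j = (\<lambda>p. \<Sum>i = 1..r. (if i = j then 1 else 0) * X i p)"
      using j by (intro ext) (simp add: if_distrib[of "\<lambda>x. x * _"] cong: if_cong)
    then have "X j \<in> span_x r X"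
      unfolding span_x_def by (intro CollectI exI[of _ "\<lambda>i. if i = j then 1 else 0"])
    then have "inner_x g \<phi> (X j) = inner_x g \<psi> (X j)"
      using \<psi> by (simp add: inner_x_diff)
    then show ?thesis using inner_x_orthonormal_sum[OF assms j] by (simp add: c)
  qed
  then show "\<psi> = expansion g r X \<phi>"
    by (intro ext) (simp add: c expansion_def)
qed

lemma proj_X_eq:
  assumes "orthonormal_x g r X"
  shows "proj_X g r X f p q = (\<Sum>i = 1..r. inner_x g (\<lambda>p'. f p' q) (X i) * X i p)"
  by (simp add: proj_X_def proj_x_eq_expansion[OF assms] expansion_def)

lemma norm_xv_proj_X_residual_le:
  assumes g: "valid_grid g" and X: "orthonormal_x g r X"
  shows "norm_xv g (\<lambda>p q. f p q - proj_X g r X f p q) \<le> norm_xv g f"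
proof -
  define R where "R p q = f p q - proj_X g r X f p q" for p q
  have column: "inner_x g (\<lambda>p. R p q) (\<lambda>p. R p q) \<le> inner_x g (\<lambda>p. f p q) (\<lambda>p. f p q)" for q
  proof -
    let ?e = "expansion g r X (\<lambda>p. f p q)"
    have R: "R p q = f p q - ?e p" for p
      by (simp add: R_def proj_X_def proj_x_eq_expansion[OF X])
    from expansion_residual_orthogonal[OF X expansion_in_span, of "\<lambda>p. f p q"]
    have orth: "inner_x g (\<lambda>p. R p q) ?e = 0" by (simp add: R)
    have "inner_x g (\<lambda>p. f p q) (\<lambda>p. f p q)
        = inner_x g (\<lambda>p. R p q) (\<lambda>p. R p q) + 2 * inner_x g (\<lambda>p. R p q) ?e + inner_x g ?e ?e"
      by (simp add: inner_x_def R sum_distrib_left sum.distrib[symmetric] algebra_simps)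
    moreover have "0 \<le> inner_x g ?e ?e"
      using dx_pos[OF g] by (auto simp: inner_x_def intro!: sum_nonneg)
    ultimately show ?thesis using orth by simp
  qed
  have eq: "inner_xv g h h = (\<Sum>q = 1..Nv g. inner_x g (\<lambda>p. h p q) (\<lambda>p. h p q) * dv g)" for h
    unfolding inner_xv_def inner_x_def sum_distrib_right
    by (subst sum.swap) simp
  have "inner_xv g R R \<le> inner_xv g f f"
    unfolding eq using dv_pos[OF g] by (intro sum_mono mult_right_mono column) simp
  then show ?thesis by (simp add: norm_xv_def R_def[abs_def])
qed

text \<open>The part of \<open>f\<close> whose columns lie in the span is reproduced by the projector, so \<open>f\<close> and \<open>R\<close> have
  the same residual, and residuals do not exceed the original in norm.\<close>

lemma norm_xv_le_proj_X_plus_residual: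
  assumes g: "valid_grid g" and X: "orthonormal_x g r X"
    and f: "\<And>p q. p \<in> {1..Nx g} \<Longrightarrow> q \<in> {1..Nv g} \<Longrightarrow> f p q = (\<Sum>i = 1..r. X i p * c i q) + R p q"
  shows "norm_xv g f \<le> norm_xv g (proj_X g r X f) + norm_xv g R"
proof -
  have res: "f p q - proj_X g r X f p q = R p q - proj_X g r X R p q"
    if pq: "p \<in> {1..Nx g}" "q \<in> {1..Nv g}" for p q
  proof -
    have "inner_x g (\<lambda>p. f p q) (X i) = c i q + inner_x g (\<lambda>p. R p q) (X i)" if i: "i \<in> {1..r}" for i
    proof -
      have "inner_x g (\<lambda>p. f p q) (X i)
          = inner_x g (\<lambda>p. \<Sum>i = 1..r. c i q * X i p) (X i) + inner_x g (\<lambda>p. R p q) (X i)"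
        using f[OF _ pq(2)] by (simp add: inner_x_def sum.distrib[symmetric] algebra_simps)
      then show ?thesis using inner_x_orthonormal_sum[OF X i] by simp
    qed
    then have "proj_X g r X f p q = (\<Sum>i = 1..r. X i p * c i q) + proj_X g r X R p q"
      by (simp add: proj_X_eq[OF X] sum.distrib[symmetric] algebra_simps)
    then show ?thesis using f[OF pq] by simp
  qed
  have "norm_xv g f = norm_xv g (\<lambda>p q. proj_X g r X f p q + (f p q - proj_X g r X f p q))" by simp
  also have "\<dots> \<le> norm_xv g (proj_X g r X f) + norm_xv g (\<lambda>p q. f p q - proj_X g r X f p q)"
    by (rule norm_xv_triangle[OF g])
  also have "norm_xv g (\<lambda>p q. f p q - proj_X g r X f p q) = norm_xv g (\<lambda>p q. R p q - proj_X g r X R p q)"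
    by (rule norm_xv_cong) (rule res)
  also have "\<dots> \<le> norm_xv g R" by (rule norm_xv_proj_X_residual_le[OF g X])
  finally show ?thesis by simp
qed

text \<open>Multiplying the L-step equations by \<open>X_new d i\<close> and summing over \<open>i\<close> shows that \<open>G_new\<close> is exactly
  the projected Fokker--Planck term divided by \<open>\<epsilon>\<close>.\<close>

lemma L_step_proj_fokker_planck:
  assumes g: "valid_grid g" and X: "orthonormal_x g r (X_new d)"
    and "0 < \<epsilon>" and step: "L_step g A E dt \<epsilon> r d"
  shows "norm_xv g (proj_X g r (X_new d) (fokker_planck g E (f_new r d)))
    \<le> \<epsilon> * norm_xv g (G_new g A dt r d)"
proof (rule norm_xv_mono[OF g])
  fix p q assume q: "q \<in> {1..Nv g}"
  have "(f_new r d p q - f_two r d p q) / dt = (\<Sum>i = 1..r. X_new d i p * ((L_new d i q - L_two r d i q) / dt))"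
    by (simp add: f_new_def f_two_def sum_subtractf sum_divide_distrib diff_divide_distrib right_diff_distrib)
  also have "\<dots> = (\<Sum>i = 1..r. X_new d i p * (inner_x g (\<lambda>p. A (f_two r d) p q) (X_new d i)
          + 1 / \<epsilon> * inner_x g (\<lambda>p. fokker_planck g E (f_new r d) p q) (X_new d i)))"
    using step q by (intro sum.cong) (auto simp: L_step_def)
  also have "\<dots> = proj_X g r (X_new d) (A (f_two r d)) p q
      + 1 / \<epsilon> * proj_X g r (X_new d) (fokker_planck g E (f_new r d)) p q"
    by (simp add: proj_X_eq[OF X] sum_distrib_left sum.distrib distrib_left mult_ac)
  finally have "proj_X g r (X_new d) (fokker_planck g E (f_new r d)) p q = \<epsilon> * G_new g A dt r d p q"
    using \<open>0 < \<epsilon>\<close> by (simp add: G_new_def)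
  then show "\<bar>proj_X g r (X_new d) (fokker_planck g E (f_new r d)) p q\<bar> \<le> \<epsilon> * \<bar>G_new g A dt r d p q\<bar>"
    using \<open>0 < \<epsilon>\<close> by (simp add: abs_mult)
qed (use \<open>0 < \<epsilon>\<close> in simp)

section \<open>Fluctuation of the field\<close>

text \<open>The factor \<open>alpha_half\<close>, extended by zero to the two boundary faces. Since \<open>inverse 0 = 0\<close>, its inverse
  vanishes there too, so both encode the zero-flux condition.\<close>

definition face_weight :: "phase_grid \<Rightarrow> nat \<Rightarrow> real" where
  "face_weight g q = (if q \<in> {1..Nv g - 1} then alpha_half g q else 0)"

text \<open>The two bidiagonal operators in \<open>v\<close> that make up the Fokker--Planck operator once the dependence on
  the electric field has been pulled out. They act identically in every row, and therefore commute
  with any linear operation in \<open>x\<close>.\<close>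

definition fp_upper :: "phase_grid \<Rightarrow> phase_fun \<Rightarrow> phase_fun" where
  "fp_upper g f p q =
     (face_weight g q * f p (q + 1) - face_weight g (q - 1) * f p q) / (dv g)\<^sup>2"

definition fp_lower :: "phase_grid \<Rightarrow> phase_fun \<Rightarrow> phase_fun" where
  "fp_lower g f p q =
     (inverse (face_weight g q) * f p q - inverse (face_weight g (q - 1)) * f p (q - 1)) / (dv g)\<^sup>2"

text \<open>Completing the square: the exponents at neighbouring velocities differ by
  \<open>dv * ((v\<^sub>q + v\<^sub>q\<^sub>+\<^sub>1) / 2 - E)\<close>. The field thus enters through a factor depending on \<open>p\<close> only.\<close>

lemma maxwellian_ratio:
  assumes g: "valid_grid g"
  shows "maxwellian g E p q = (alpha_half g q * beta g E p)\<^sup>2 * maxwellian g E p (q + 1)"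
proof -
  have step: "vpt g (q + 1) = vpt g q + dv g" by (simp add: vpt_def algebra_simps)
  have "exp (- (vpt g q - E p)\<^sup>2 / 2)
      = exp (2 * (dv g / 4 * (vpt g q + vpt g (q + 1)) - dv g / 2 * E p)) * exp (- (vpt g (q + 1) - E p)\<^sup>2 / 2)"
    unfolding exp_add[symmetric] step by (simp add: power2_eq_square field_simps)
  also have "exp (2 * (dv g / 4 * (vpt g q + vpt g (q + 1)) - dv g / 2 * E p))
      = (alpha_half g q * beta g E p)\<^sup>2"
    unfolding alpha_half_def beta_def exp_add[symmetric] exp_double[symmetric] by (simp add: algebra_simps)
  finally show ?thesis by (simp add: maxwellian_def)
qed

lemma flux_eq:
  assumes g: "valid_grid g" and q: "q \<in> {1..Nv g - 1}"
  shows "flux g E f p q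
    = (beta g E p * (alpha_half g q * f p (q + 1)) - inverse (beta g E p) * (inverse (alpha_half g q) * f p q)) / dv g"
proof -
  define m where "m = maxwellian g E p (q + 1)"
  define a where "a = alpha_half g q * beta g E p"
  have m: "0 < m" using maxwellian_pos[OF g] by (simp add: m_def)
  have a: "0 < a" by (simp add: a_def alpha_half_def beta_def)
  have M: "maxwellian g E p q = a\<^sup>2 * m" unfolding a_def m_def by (rule maxwellian_ratio[OF g])
  have "maxwellian_half g E p q = sqrt (a\<^sup>2 * m * m)"
    unfolding maxwellian_half_def M m_def[symmetric] ..
  also have "a\<^sup>2 * m * m = (a * m)\<^sup>2" by (simp add: power2_eq_square)
  finally have "maxwellian_half g E p q = sqrt ((a * m)\<^sup>2)" .
  then have half: "maxwellian_half g E p q = a * m" using a m by simp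
  have cancel: "a * m * ((x / m - y / (a\<^sup>2 * m)) / \<delta>) = (a * x - inverse a * y) / \<delta>" for x y \<delta> :: real
  proof -
    have "a * m * (x / m) = a * x" "a * m * (y / (a\<^sup>2 * m)) = inverse a * y"
      using a m by (simp_all add: field_simps power2_eq_square)
    then show ?thesis by (simp add: right_diff_distrib)
  qed
  have "flux g E f p q = a * m * ((f p (q + 1) / m - f p q / (a\<^sup>2 * m)) / dv g)"
    using q unfolding flux_def half M m_def[symmetric] by (simp only: if_True)
  also have "\<dots> = (a * f p (q + 1) - inverse a * f p q) / dv g" by (rule cancel)
  also have "\<dots> = (beta g E p * (alpha_half g q * f p (q + 1))
      - inverse (beta g E p) * (inverse (alpha_half g q) * f p q)) / dv g"
    by (simp only: a_def inverse_mult_distrib mult_ac)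
  finally show ?thesis .
qed

lemma fokker_planck_split:
  assumes g: "valid_grid g"
  shows "fokker_planck g E f p q = beta g E p * fp_upper g f p q - inverse (beta g E p) * fp_lower g f p q"
proof -
  have flux: "flux g E f p k = (beta g E p * (face_weight g k * f p (k + 1))
      - inverse (beta g E p) * (inverse (face_weight g k) * f p k)) / dv g" for k
    using flux_eq[OF g, of k] by (cases "k \<in> {1..Nv g - 1}") (auto simp: flux_def face_weight_def)
  have up: "face_weight g (q - 1) * f p (q - 1 + 1) = face_weight g (q - 1) * f p q"
    by (cases q) (auto simp: face_weight_def)
  have "1 / \<delta> * ((b * u - c * l) / \<delta> - (b * u' - c * l') / \<delta>)
      = b * ((u - u') / \<delta>\<^sup>2) - c * ((l - l') / \<delta>\<^sup>2)" for b c u u' l l' \<delta> :: real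
    by (simp add: power2_eq_square diff_divide_distrib right_diff_distrib)
  then show ?thesis
    unfolding fokker_planck_def flux up fp_upper_def fp_lower_def .
qed

lemma fp_upper_sum:
  "fp_upper g (\<lambda>p q. \<Sum>i = 1..r. X i p * L i q) p q = (\<Sum>i = 1..r. X i p * fp_upper g (\<lambda>_. L i) 0 q)"
  by (simp add: fp_upper_def sum_distrib_left sum_divide_distrib sum_subtractf
      diff_divide_distrib right_diff_distrib mult_ac)

lemma fp_lower_sum:
  "fp_lower g (\<lambda>p q. \<Sum>i = 1..r. X i p * L i q) p q = (\<Sum>i = 1..r. X i p * fp_lower g (\<lambda>_. L i) 0 q)"
  by (simp add: fp_lower_def sum_distrib_left sum_divide_distrib sum_subtractf
      diff_divide_distrib right_diff_distrib mult_ac)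

lemma norm_xv_shift_up_le:
  assumes g: "valid_grid g"
  shows "norm_xv g (\<lambda>p q. if q \<in> {1..Nv g - 1} then f p (q + 1) else 0) \<le> norm_xv g f"
proof (rule norm_xv_mono_rows[OF g])
  fix p
  have "(\<Sum>q = 1..Nv g. (if q \<in> {1..Nv g - 1} then f p (q + 1) else 0)\<^sup>2) = (\<Sum>q = 1..Nv g - 1. (f p (q + 1))\<^sup>2)"
    by (rule sum.mono_neutral_cong_right) auto
  also have "\<dots> = (\<Sum>q\<in>Suc ` {1..Nv g - 1}. (f p q)\<^sup>2)"
    by (subst sum.reindex) auto
  also have "\<dots> \<le> (\<Sum>q = 1..Nv g. (f p q)\<^sup>2)"
    by (rule sum_mono2) auto
  finally show "(\<Sum>q = 1..Nv g. (if q \<in> {1..Nv g - 1} then f p (q + 1) else 0)\<^sup>2) \<le> (\<Sum>q = 1..Nv g. (f p q)\<^sup>2)" .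
qed

lemma norm_xv_shift_down_le:
  assumes g: "valid_grid g"
  shows "norm_xv g (\<lambda>p q. if q - 1 \<in> {1..Nv g - 1} then f p (q - 1) else 0) \<le> norm_xv g f"
proof (rule norm_xv_mono_rows[OF g])
  fix p
  have "(\<Sum>q = 1..Nv g. (if q - 1 \<in> {1..Nv g - 1} then f p (q - 1) else 0)\<^sup>2) = (\<Sum>q\<in>Suc ` {1..Nv g - 1}. (f p (q - 1))\<^sup>2)"
    by (rule sum.mono_neutral_cong_right) (auto simp: image_Suc_atLeastAtMost)
  also have "\<dots> = (\<Sum>q = 1..Nv g - 1. (f p q)\<^sup>2)"
    by (subst sum.reindex) auto
  also have "\<dots> \<le> (\<Sum>q = 1..Nv g. (f p q)\<^sup>2)"
    by (rule sum_mono2) auto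
  finally show "(\<Sum>q = 1..Nv g. (if q - 1 \<in> {1..Nv g - 1} then f p (q - 1) else 0)\<^sup>2) \<le> (\<Sum>q = 1..Nv g. (f p q)\<^sup>2)" .
qed

lemma alpha_half_pos: "0 < alpha_half g q"
  by (simp add: alpha_half_def)

lemma alpha_max_pos:
  assumes "valid_grid g" shows "0 < alpha_max g"
proof -
  have "alpha_half g 1 \<le> alpha_max g"
    unfolding alpha_max_def using assms by (intro Max_ge) (auto simp: valid_grid_def)
  then show ?thesis using alpha_half_pos[of g 1] by linarith
qed

lemma alpha_min_pos:
  assumes "valid_grid g" shows "0 < alpha_min g"
  unfolding alpha_min_def using assms
  by (subst Min_gr_iff) (auto simp: alpha_half_pos valid_grid_def)

lemma face_weight_bounds:
  assumes g: "valid_grid g"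
  shows "\<bar>face_weight g q\<bar> \<le> alpha_max g" and "\<bar>inverse (face_weight g q)\<bar> \<le> inverse (alpha_min g)"
proof -
  have "0 < alpha_half g q \<and> alpha_half g q \<le> alpha_max g \<and> alpha_min g \<le> alpha_half g q"
    if "q \<in> {1..Nv g - 1}"
    using that alpha_half_pos unfolding alpha_max_def alpha_min_def
    by (auto intro!: Max_ge Min_le)
  then show "\<bar>face_weight g q\<bar> \<le> alpha_max g" "\<bar>inverse (face_weight g q)\<bar> \<le> inverse (alpha_min g)"
    using alpha_max_pos[OF g] alpha_min_pos[OF g]
    by (auto simp: face_weight_def intro!: le_imp_inverse_le)
qed

lemma norm_xv_difference_quotient_le:
  assumes g: "valid_grid g" and c: "0 \<le> c"
    and a: "\<And>p q. \<bar>a p q\<bar> \<le> c * \<bar>a' p q\<bar>" and b: "\<And>p q. \<bar>b p q\<bar> \<le> c * \<bar>b' p q\<bar>"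
    and a': "norm_xv g a' \<le> n" and b': "norm_xv g b' \<le> n"
  shows "norm_xv g (\<lambda>p q. (a p q - b p q) / (dv g)\<^sup>2) \<le> 2 * c / (dv g)\<^sup>2 * n"
proof -
  let ?k = "c / (dv g)\<^sup>2"
  have k: "0 \<le> ?k" using c by simp
  have scale: "norm_xv g (\<lambda>p q. s * u p q / (dv g)\<^sup>2) \<le> ?k * n"
    if s: "\<bar>s\<bar> = 1" and u: "\<And>p q. \<bar>u p q\<bar> \<le> c * \<bar>u' p q\<bar>" and n: "norm_xv g u' \<le> n" for s u u'
  proof -
    have "norm_xv g (\<lambda>p q. s * u p q / (dv g)\<^sup>2) \<le> ?k * norm_xv g u'"
      using s divide_right_mono[OF u, of "(dv g)\<^sup>2"]
      by (intro norm_xv_mono[OF g k]) (simp add: abs_divide abs_mult)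
    also have "\<dots> \<le> ?k * n" by (intro mult_left_mono n k)
    finally show ?thesis .
  qed
  have "norm_xv g (\<lambda>p q. (a p q - b p q) / (dv g)\<^sup>2)
      = norm_xv g (\<lambda>p q. 1 * a p q / (dv g)\<^sup>2 + - 1 * b p q / (dv g)\<^sup>2)"
    by (simp add: diff_divide_distrib)
  also have "\<dots> \<le> ?k * n + ?k * n"
    using norm_xv_triangle[OF g] add_mono[OF scale[OF _ a a'] scale[OF _ b b']]
    by (rule order_trans) auto
  finally show ?thesis by simp
qed

lemma norm_xv_fp_upper_le:
  assumes g: "valid_grid g"
  shows "norm_xv g (fp_upper g f) \<le> 2 * alpha_max g / (dv g)\<^sup>2 * norm_xv g f"
  unfolding fp_upper_def[abs_def]
proof (rule norm_xv_difference_quotient_le[OF g,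
      where a' = "\<lambda>p q. if q \<in> {1..Nv g - 1} then f p (q + 1) else 0" and b' = f])
  show "norm_xv g (\<lambda>p q. if q \<in> {1..Nv g - 1} then f p (q + 1) else 0) \<le> norm_xv g f"
    by (rule norm_xv_shift_up_le[OF g])
  show "\<bar>face_weight g q * f p (q + 1)\<bar>
      \<le> alpha_max g * \<bar>if q \<in> {1..Nv g - 1} then f p (q + 1) else 0\<bar>" for p q
    using mult_right_mono[OF face_weight_bounds(1)[OF g, of q], of "\<bar>f p (q + 1)\<bar>"]
    by (auto simp: abs_mult face_weight_def)
  show "\<bar>face_weight g (q - 1) * f p q\<bar> \<le> alpha_max g * \<bar>f p q\<bar>" for p q
    unfolding abs_mult by (intro mult_right_mono face_weight_bounds[OF g]) simp
qed (use alpha_max_pos[OF g] in auto)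

lemma norm_xv_fp_lower_le:
  assumes g: "valid_grid g"
  shows "norm_xv g (fp_lower g f) \<le> 2 * inverse (alpha_min g) / (dv g)\<^sup>2 * norm_xv g f"
  unfolding fp_lower_def[abs_def]
proof (rule norm_xv_difference_quotient_le[OF g, where a' = f
      and b' = "\<lambda>p q. if q - 1 \<in> {1..Nv g - 1} then f p (q - 1) else 0"])
  show "norm_xv g (\<lambda>p q. if q - 1 \<in> {1..Nv g - 1} then f p (q - 1) else 0) \<le> norm_xv g f"
    by (rule norm_xv_shift_down_le[OF g])
  show "\<bar>inverse (face_weight g (q - 1)) * f p (q - 1)\<bar>
      \<le> inverse (alpha_min g) * \<bar>if q - 1 \<in> {1..Nv g - 1} then f p (q - 1) else 0\<bar>" for p q
    using mult_right_mono[OF face_weight_bounds(2)[OF g, of "q - 1"], of "\<bar>f p (q - 1)\<bar>"]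
    by (auto simp: abs_mult face_weight_def)
  show "\<bar>inverse (face_weight g q) * f p q\<bar> \<le> inverse (alpha_min g) * \<bar>f p q\<bar>" for p q
    unfolding abs_mult by (intro mult_right_mono face_weight_bounds[OF g]) simp
qed (use alpha_min_pos[OF g] in auto)

lemma beta_bar_pos:
  assumes "valid_grid g" shows "0 < beta_bar g E"
proof -
  have "0 < (\<Sum>p = 1..Nx g. beta g E p)"
    using assms by (intro sum_pos) (auto simp: beta_def valid_grid_def)
  then show ?thesis using assms by (simp add: beta_bar_def valid_grid_def)
qed

text \<open>The second bound is the identity \<open>1/x - 1/y = (y - x)/(x y)\<close>, which is where \<open>C_beta\<close> comes from.\<close>

lemma beta_dev_bounds:
  assumes g: "valid_grid g" and p: "p \<in> {1..Nx g}"
  shows "\<bar>beta g E p - beta_bar g E\<bar> \<le> beta_dev g E"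
    and "\<bar>inverse (beta g E p) - inverse (beta_bar g E)\<bar> \<le> beta_dev g E * C_beta g E"
proof -
  show dev: "\<bar>beta g E p - beta_bar g E\<bar> \<le> beta_dev g E"
    unfolding beta_dev_def using p by (intro Max_ge) auto
  have C: "inverse (beta g E p * beta_bar g E) \<le> C_beta g E"
    unfolding C_beta_def using p by (intro Max_ge) auto
  have pos: "0 < beta g E p" "0 < beta_bar g E" using beta_bar_pos[OF g] by (auto simp: beta_def)
  have "inverse (beta g E p) - inverse (beta_bar g E)
      = - ((beta g E p - beta_bar g E) * inverse (beta g E p * beta_bar g E))"
    using pos by (simp add: field_simps)
  then have "\<bar>inverse (beta g E p) - inverse (beta_bar g E)\<bar>
      = \<bar>beta g E p - beta_bar g E\<bar> * inverse (beta g E p * beta_bar g E)"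
    using pos by (simp add: abs_mult)
  also have "\<dots> \<le> beta_dev g E * C_beta g E"
    using dev C pos by (intro mult_mono) auto
  finally show "\<bar>inverse (beta g E p) - inverse (beta_bar g E)\<bar> \<le> beta_dev g E * C_beta g E" .
qed

lemma kappa_h_nonneg:
  assumes g: "valid_grid g" shows "0 \<le> kappa_h g E"
proof -
  have p: "1 \<in> {1..Nx g}" using g by (simp add: valid_grid_def)
  have 1: "0 \<le> beta_dev g E" and 2: "0 \<le> beta_dev g E * C_beta g E"
    using beta_dev_bounds[OF g p, of E] by linarith+
  show ?thesis
    using 1 2 alpha_max_pos[OF g] alpha_min_pos[OF g]
    by (simp add: kappa_h_def distrib_left mult.assoc[symmetric])
qed

text \<open>Replacing every \<open>beta g E p\<close> by the average \<open>beta_bar g E\<close> yields an operator that acts on the \<open>L i\<close>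
  only, so it maps \<open>f\<close> to a grid function whose columns still lie in the span of the \<open>X i\<close>. What
  the projector misses is therefore caused by the fluctuation of \<open>beta\<close>, whose effect \<open>kappa_h\<close> bounds.\<close>

lemma fokker_planck_le_proj_plus_fluctuation:
  assumes g: "valid_grid g" and X: "orthonormal_x g r X"
    and f: "f = (\<lambda>p q. \<Sum>i = 1..r. X i p * L i q)"
  shows "norm_xv g (fokker_planck g E f)
    \<le> norm_xv g (proj_X g r X (fokker_planck g E f)) + kappa_h g E * norm_xv g f"
proof -
  define b where "b = beta_bar g E"
  define c where "c i q = b * fp_upper g (\<lambda>_. L i) 0 q - inverse b * fp_lower g (\<lambda>_. L i) 0 q" for i q
  define R1 where "R1 p q = (beta g E p - b) * fp_upper g f p q" for p q
  define R2 where "R2 p q = - ((inverse (beta g E p) - inverse b) * fp_lower g f p q)" for p q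
  have p1: "1 \<in> {1..Nx g}" using g by (simp add: valid_grid_def)
  have dev: "0 \<le> beta_dev g E" "0 \<le> beta_dev g E * C_beta g E"
    using beta_dev_bounds[OF g p1, of E] by linarith+
  have "fokker_planck g E f p q = (\<Sum>i = 1..r. X i p * c i q) + (R1 p q + R2 p q)" for p q
  proof -
    have "(\<Sum>i = 1..r. X i p * c i q) = b * fp_upper g f p q - inverse b * fp_lower g f p q"
      unfolding f fp_upper_sum fp_lower_sum
      by (simp add: c_def sum_distrib_left sum_subtractf[symmetric] algebra_simps)
    then show ?thesis
      by (simp add: fokker_planck_split[OF g] R1_def R2_def algebra_simps)
  qed
  from norm_xv_le_proj_X_plus_residual[OF g X this]
  have "norm_xv g (fokker_planck g E f)
      \<le> norm_xv g (proj_X g r X (fokker_planck g E f)) + norm_xv g (\<lambda>p q. R1 p q + R2 p q)" .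
  also have "norm_xv g (\<lambda>p q. R1 p q + R2 p q) \<le> norm_xv g R1 + norm_xv g R2"
    by (rule norm_xv_triangle[OF g])
  also have "norm_xv g R1 \<le> beta_dev g E * norm_xv g (fp_upper g f)"
    using dev beta_dev_bounds(1)[OF g]
    by (intro norm_xv_mono[OF g]) (auto simp: R1_def b_def abs_mult intro!: mult_right_mono)
  also have "norm_xv g R2 \<le> beta_dev g E * C_beta g E * norm_xv g (fp_lower g f)"
    using dev beta_dev_bounds(2)[OF g]
    by (intro norm_xv_mono[OF g]) (auto simp: R2_def b_def abs_mult intro!: mult_right_mono)
  also have "beta_dev g E * norm_xv g (fp_upper g f)
      \<le> beta_dev g E * (2 * alpha_max g / (dv g)\<^sup>2 * norm_xv g f)"
    by (intro mult_left_mono norm_xv_fp_upper_le[OF g] dev)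
  also have "beta_dev g E * C_beta g E * norm_xv g (fp_lower g f)
      \<le> beta_dev g E * C_beta g E * (2 * inverse (alpha_min g) / (dv g)\<^sup>2 * norm_xv g f)"
    by (intro mult_left_mono norm_xv_fp_lower_le[OF g] dev)
  also have "norm_xv g (proj_X g r X (fokker_planck g E f))
      + (beta_dev g E * (2 * alpha_max g / (dv g)\<^sup>2 * norm_xv g f)
         + beta_dev g E * C_beta g E * (2 * inverse (alpha_min g) / (dv g)\<^sup>2 * norm_xv g f))
      = norm_xv g (proj_X g r X (fokker_planck g E f)) + kappa_h g E * norm_xv g f"
    by (simp add: kappa_h_def distrib_left distrib_right mult_ac divide_inverse)
  finally show ?thesis by simp
qed

section \<open>Distance to the local Maxwellian\<close>

theorem theorem5p3:
  fixes g :: phase_grid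
    and A :: "phase_fun \<Rightarrow> phase_fun"
    and E :: grid_fun
    and dt :: real
    and r :: nat
    and Eps :: "real set"
    and d :: "real \<Rightarrow> imex_data"
  assumes grid: "valid_grid g"
    and adv: "linear_grid_operator g A"
    and dt: "0 < dt"
    and eps: "Eps \<subseteq> {0<..}"
    and scheme: "\<And>\<epsilon>. \<epsilon> \<in> Eps \<Longrightarrow> imex_step g A E dt \<epsilon> r (d \<epsilon>)"
    and small: "kappa_h g E * M_max g E < gamma_h g E"
    and regime: "(\<lambda>\<epsilon>. norm_xv g (G_new g A dt r (d \<epsilon>))) \<in> O[at 0 within Eps](\<lambda>\<epsilon>. 1)"
  shows "1 \<le> Theta g E \<and>
    (\<forall>\<epsilon>\<in>Eps.
       norm_xv g (fokker_planck g E (f_new r (d \<epsilon>)))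
         \<le> Theta g E *
             (\<epsilon> * norm_xv g (G_new g A dt r (d \<epsilon>))
              + kappa_h g E * M_max g E * sqrt (Lv g) * norm_x g (density g (f_new r (d \<epsilon>)))) \<and>
       norm_xv g (\<lambda>p q. f_new r (d \<epsilon>) p q - density g (f_new r (d \<epsilon>)) p * maxwellian g E p q)
         \<le> M_max g E / gamma_h g E * Theta g E *
             (\<epsilon> * norm_xv g (G_new g A dt r (d \<epsilon>))
              + kappa_h g E * M_max g E * sqrt (Lv g) * norm_x g (density g (f_new r (d \<epsilon>)))))"
proof (intro conjI ballI)
  define \<kappa> M \<gamma> where "\<kappa> = kappa_h g E" and "M = M_max g E" and "\<gamma> = gamma_h g E"
  have \<kappa>: "0 \<le> \<kappa>" and M: "0 < M" and \<gamma>: "0 < \<gamma>" and gap: "0 < \<gamma> - \<kappa> * M"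
    using kappa_h_nonneg[OF grid] M_max_pos[OF grid] gamma_h_pos[OF grid] small
    by (auto simp: \<kappa>_def M_def \<gamma>_def)
  have Theta: "Theta g E = \<gamma> / (\<gamma> - \<kappa> * M)" by (simp add: Theta_def \<gamma>_def \<kappa>_def M_def)
  show "1 \<le> Theta g E"
    using \<kappa> M gap by (simp add: Theta)
  fix \<epsilon> assume "\<epsilon> \<in> Eps"
  then have \<epsilon>: "0 < \<epsilon>" and step: "imex_step g A E dt \<epsilon> r (d \<epsilon>)"
    using eps scheme by auto
  define f where "f = f_new r (d \<epsilon>)"
  define \<rho> where "\<rho> = density g f"
  define F where "F = norm_xv g (fokker_planck g E f)"
  define B where "B = \<epsilon> * norm_xv g (G_new g A dt r (d \<epsilon>)) + \<kappa> * M * sqrt (Lv g) * norm_x g \<rho>"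
  have X: "orthonormal_x g r (X_new (d \<epsilon>))" and Lst: "L_step g A E dt \<epsilon> r (d \<epsilon>)"
    using step by (auto simp: imex_step_def QR_step_def)
  have lift: "norm_xv g (\<lambda>p q. f p q - \<rho> p * maxwellian g E p q) \<le> M / \<gamma> * F"
    using maxwellian_deviation_le[OF grid] by (simp add: M_def \<gamma>_def F_def \<rho>_def)
  have "norm_xv g f = norm_xv g (\<lambda>p q. (f p q - \<rho> p * maxwellian g E p q) + \<rho> p * maxwellian g E p q)"
    by simp
  also have "\<dots> \<le> M / \<gamma> * F + M * sqrt (Lv g) * norm_x g \<rho>"
    by (rule order_trans[OF norm_xv_triangle[OF grid] add_mono[OF lift]])
      (simp add: M_def norm_xv_local_maxwellian_le[OF grid])
  finally have norm_f: "norm_xv g f \<le> M / \<gamma> * F + M * sqrt (Lv g) * norm_x g \<rho>" .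
  have "F \<le> norm_xv g (proj_X g r (X_new (d \<epsilon>)) (fokker_planck g E f)) + \<kappa> * norm_xv g f"
    unfolding F_def \<kappa>_def
    by (rule fokker_planck_le_proj_plus_fluctuation[OF grid X]) (simp add: f_def f_new_def[abs_def])
  also have "\<dots> \<le> \<epsilon> * norm_xv g (G_new g A dt r (d \<epsilon>)) + \<kappa> * norm_xv g f"
    using L_step_proj_fokker_planck[OF grid X \<epsilon> Lst] by (simp add: f_def)
  also have "\<dots> \<le> \<epsilon> * norm_xv g (G_new g A dt r (d \<epsilon>))
      + \<kappa> * (M / \<gamma> * F + M * sqrt (Lv g) * norm_x g \<rho>)"
    using \<kappa> norm_f by (intro add_left_mono mult_left_mono)
  \<comment> \<open>The bound on \<open>f\<close> brings \<open>F\<close> back on the right with factor \<open>\<kappa> * M / \<gamma> < 1\<close>; absorbing it produces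
    \<open>Theta\<close>.\<close>
  finally have "F \<le> B + \<kappa> * M / \<gamma> * F" by (simp add: B_def algebra_simps)
  then have "F * (\<gamma> - \<kappa> * M) \<le> \<gamma> * B" using \<gamma> by (simp add: field_simps)
  then have F: "F \<le> Theta g E * B" using gap by (simp add: Theta field_simps)
  then show "norm_xv g (fokker_planck g E (f_new r (d \<epsilon>)))
      \<le> Theta g E * (\<epsilon> * norm_xv g (G_new g A dt r (d \<epsilon>))
          + kappa_h g E * M_max g E * sqrt (Lv g) * norm_x g (density g (f_new r (d \<epsilon>))))"
    by (simp add: F_def B_def \<kappa>_def M_def \<rho>_def f_def)
  have "M / \<gamma> * F \<le> M / \<gamma> * (Theta g E * B)"
    using F M \<gamma> by (intro mult_left_mono) auto
  with lift have "norm_xv g (\<lambda>p q. f p q - \<rho> p * maxwellian g E p q) \<le> M / \<gamma> * Theta g E * B"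
    by (simp add: mult.assoc)
  then show "norm_xv g (\<lambda>p q. f_new r (d \<epsilon>) p q - density g (f_new r (d \<epsilon>)) p * maxwellian g E p q)
      \<le> M_max g E / gamma_h g E * Theta g E * (\<epsilon> * norm_xv g (G_new g A dt r (d \<epsilon>))
          + kappa_h g E * M_max g E * sqrt (Lv g) * norm_x g (density g (f_new r (d \<epsilon>))))"
    by (simp add: B_def \<kappa>_def M_def \<gamma>_def \<rho>_def f_def)
qed

end
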